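(* Let $W$ be a cyclic vacuum representation of the CCR over $\mathbb{C}$ on a Hilbert space $\mathcal{H}$, with number operator $N$ and projections $P_n$ ($n\in\mathbb{N}$) onto the eigenspaces of $N$. For every $s\in(-1,1)$ the operator $s^N$ can be written as a strong integral over the Weyl operators: $$s^N=\frac1\pi\int_{\mathbb{C}}\frac{e^{-\frac12\frac{1+s}{1-s}|z|^2}}{1-s}\,W(z)\,\lambda_2(dz).$$ Furthermore, for every $n\in\mathbb{N}$, $$P_n=\frac{1}{n!}\left[\frac{d^n}{ds^n}s^N\right]_{s=0},$$ where the derivative can be taken in the strong operator topology.
   Context: A cyclic vacuum representation of the CCR over $\mathbb{C}$ is a map $W$ from $\mathbb{C}$ to the unitary operators on a Hilbert space $\mathcal{H}$ such that $W(z)W(w)=e^{-i\,\mathrm{Im}(\bar z w)}W(z+w)$ for all $z,w\in\mathbb{C}$, $t\mapsto W(tz)\xi$ is continuous on $\mathbb{R}$ for all $z\in\mathbb{C},\xi\in\mathcal{H}$, and there is a unit vector $\Omega$ with $\langle\Omega,W(z)\Omega\rangle=e^{-\frac12|z|^2}$ for all $z$ and $\{W(z)\Omega\}$ total in $\mathcal{H}$. Such a representation is unique up to unitary equivalence. There is an orthonormal basis $(e_n)_{n\in\mathbb{N}}$ of $\mathcal{H}$ ($\mathbb{N}=\{0,1,2,\dots\}$) determined by $W(z)\Omega=e^{-\frac12|z|^2}\sum_{n\ge0}\frac{z^n}{\sqrt{n!}}e_n$ for all $z\in\mathbb{C}$. $P_n$ is the orthogonal projection onto $\mathbb{C}e_n$,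 $N$ is the self-adjoint number operator with $Ne_n=ne_n$, and $s^N=\sum_{n\ge0}s^nP_n$ (with $0^0=1$). $\lambda_2$ is Lebesgue measure on $\mathbb{C}\cong\mathbb{R}^2$; the integral $T=\int\rho(z)W(z)\lambda_2(dz)$ is the bounded operator with $\langle\eta,T\xi\rangle=\int\rho(z)\langle\eta,W(z)\xi\rangle\lambda_2(dz)$ for all $\xi,\eta\in\mathcal{H}$. *)

theory Defs
  imports "HOL-Analysis.Analysis"
begin

section \<open>Complex Hilbert spaces\<close>

text \<open>
  Completeness and the compatibility of norm, distance and topology come from \<^class>\<open>banach\<close>.
  The inner product is conjugate linear in the first and linear in the second argument; its
  positive definiteness follows from the last axiom, since the norm is nonnegative and definite.
\<close>

class chilbert_space = banach +
  fixes scaleC :: "complex \<Rightarrow> 'a \<Rightarrow> 'a"  (infixr "*\<^sub>C" 75)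
    and cinner :: "'a \<Rightarrow> 'a \<Rightarrow> complex"
  assumes scaleC_add_right: "c *\<^sub>C (x + y) = c *\<^sub>C x + c *\<^sub>C y"
    and scaleC_add_left: "(c + d) *\<^sub>C x = c *\<^sub>C x + d *\<^sub>C x"
    and scaleC_scaleC: "c *\<^sub>C d *\<^sub>C x = (c * d) *\<^sub>C x"
    and scaleR_scaleC: "r *\<^sub>R x = complex_of_real r *\<^sub>C x"
    and cinner_commute: "cinner x y = cnj (cinner y x)"
    and cinner_add_right: "cinner x (y + z) = cinner x y + cinner x z"
    and cinner_scaleC_right: "cinner x (c *\<^sub>C y) = c * cinner x y"
    and norm_eq_sqrt_cinner: "norm x = sqrt (Re (cinner x x))"

lemma vector_space_scaleC: "vector_space (scaleC :: complex \<Rightarrow> 'a::chilbert_space \<Rightarrow> 'a)"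
proof
  fix x :: 'a
  show "1 *\<^sub>C x = x"
    using scaleR_scaleC[of 1 x] by simp
qed (simp_all add: scaleC_add_right scaleC_add_left scaleC_scaleC)

definition cspan :: "'a::chilbert_space set \<Rightarrow> 'a set"
  where "cspan = module.span scaleC"

definition bounded_clinear :: "('a::chilbert_space \<Rightarrow> 'b::chilbert_space) \<Rightarrow> bool"
  where "bounded_clinear T \<longleftrightarrow> bounded_linear T \<and> (\<forall>c x. T (c *\<^sub>C x) = c *\<^sub>C T x)"

definition unitary :: "('a::chilbert_space \<Rightarrow> 'a) \<Rightarrow> bool"
  where "unitary U \<longleftrightarrow> bounded_clinear U \<and> surj U \<and> (\<forall>x y. cinner (U x) (U y) = cinner x y)"

definition orthonormal_basis :: "(nat \<Rightarrow> 'a::chilbert_space) \<Rightarrow> bool"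
  where "orthonormal_basis e \<longleftrightarrow>
    (\<forall>m n. cinner (e m) (e n) = (if m = n then 1 else 0)) \<and> closure (cspan (range e)) = UNIV"

definition orth_proj :: "'a::chilbert_space set \<Rightarrow> 'a \<Rightarrow> 'a"
  where "orth_proj M x = (THE p. p \<in> M \<and> (\<forall>m\<in>M. cinner m (x - p) = 0))"


section \<open>Unbounded operators\<close>

text \<open>Unbounded operators are represented by their graphs.\<close>

definition adjoint_op :: "('a::chilbert_space \<times> 'a) set \<Rightarrow> ('a \<times> 'a) set"
  where "adjoint_op A = {(x, y). \<forall>(u, v)\<in>A. cinner x v = cinner y u}"

definition self_adjoint :: "('a::chilbert_space \<times> 'a) set \<Rightarrow> bool"
  where "self_adjoint A \<longleftrightarrow> closure (Domain A) = UNIV \<and> adjoint_op A = A"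

definition eigenspace :: "('a::chilbert_space \<times> 'a) set \<Rightarrow> complex \<Rightarrow> 'a set"
  where "eigenspace A c = {x. (x, c *\<^sub>C x) \<in> A}"

text \<open>
  The operator \<open>e\<^sub>n \<mapsto> n e\<^sub>n\<close> on its maximal domain. It is shown below to be self-adjoint
  and to have eigenspaces \<open>\<complex> e\<^sub>n\<close>.
\<close>

definition number_op_of :: "(nat \<Rightarrow> 'a::chilbert_space) \<Rightarrow> ('a \<times> 'a) set"
  where "number_op_of e = {(x, y). (\<lambda>n. (of_nat n * cinner (e n) x) *\<^sub>C e n) sums y}"


section \<open>Cyclic vacuum representations of the CCR\<close>

definition cyclic_vacuum_rep :: "(complex \<Rightarrow> 'a::chilbert_space \<Rightarrow> 'a) \<Rightarrow> 'a \<Rightarrow> bool"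
  where "cyclic_vacuum_rep W \<Omega> \<longleftrightarrow>
    (\<forall>z. unitary (W z)) \<and>
    (\<forall>z w x. W z (W w x) = exp (- \<i> * of_real (Im (cnj z * w))) *\<^sub>C W (z + w) x) \<and>
    (\<forall>z x. continuous_on UNIV (\<lambda>t::real. W (of_real t * z) x)) \<and>
    norm \<Omega> = 1 \<and>
    (\<forall>z. cinner \<Omega> (W z \<Omega>) = of_real (exp (- (1/2) * (cmod z)\<^sup>2))) \<and>
    closure (cspan (range (\<lambda>z. W z \<Omega>))) = UNIV"

definition number_basis :: "(complex \<Rightarrow> 'a::chilbert_space \<Rightarrow> 'a) \<Rightarrow> 'a \<Rightarrow> nat \<Rightarrow> 'a"
  where "number_basis W \<Omega> = (THE e. orthonormal_basis e \<and>
    (\<forall>z. (\<lambda>n. (of_real (exp (- (1/2) * (cmod z)\<^sup>2)) * (z ^ n / of_real (sqrt (fact n)))) *\<^sub>C e n)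
          sums W z \<Omega>))"

definition number_op :: "(complex \<Rightarrow> 'a::chilbert_space \<Rightarrow> 'a) \<Rightarrow> 'a \<Rightarrow> ('a \<times> 'a) set"
  where "number_op W \<Omega> = number_op_of (number_basis W \<Omega>)"

definition number_proj :: "(complex \<Rightarrow> 'a::chilbert_space \<Rightarrow> 'a) \<Rightarrow> 'a \<Rightarrow> nat \<Rightarrow> 'a \<Rightarrow> 'a"
  where "number_proj W \<Omega> n = orth_proj (eigenspace (number_op W \<Omega>) (of_nat n))"

text \<open>\<open>s\<^sup>N\<close>, as a strongly convergent series.\<close>

definition number_power :: "(complex \<Rightarrow> 'a::chilbert_space \<Rightarrow> 'a) \<Rightarrow> 'a \<Rightarrow> real \<Rightarrow> 'a \<Rightarrow> 'a"
  where "number_power W \<Omega> s x = (\<Sum>n. s ^ n *\<^sub>R number_proj W \<Omega> n x)"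


section \<open>Operator-valued integrals and derivatives\<close>

definition has_operator_integral ::
    "(complex \<Rightarrow> complex) \<Rightarrow> (complex \<Rightarrow> 'a::chilbert_space \<Rightarrow> 'a) \<Rightarrow> ('a \<Rightarrow> 'a) \<Rightarrow> bool"
  where "has_operator_integral \<rho> W T \<longleftrightarrow> bounded_clinear T \<and>
    (\<forall>x y. has_bochner_integral lborel (\<lambda>z. \<rho> z * cinner y (W z x)) (cinner y (T x)))"

definition has_strong_derivative ::
    "(real \<Rightarrow> 'a::chilbert_space \<Rightarrow> 'a) \<Rightarrow> ('a \<Rightarrow> 'a) \<Rightarrow> real \<Rightarrow> bool"
  where "has_strong_derivative F D s \<longleftrightarrow> bounded_clinear D \<and>
    (\<forall>x. ((\<lambda>t. F t x) has_vector_derivative D x) (at s))"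

primrec has_nth_strong_derivative ::
    "nat \<Rightarrow> (real \<Rightarrow> 'a::chilbert_space \<Rightarrow> 'a) \<Rightarrow> ('a \<Rightarrow> 'a) \<Rightarrow> real \<Rightarrow> bool"
  where
    "has_nth_strong_derivative 0 F D s \<longleftrightarrow> D = F s"
  | "has_nth_strong_derivative (Suc n) F D s \<longleftrightarrow>
      (\<exists>F'. (\<forall>\<^sub>F t in nhds s. has_strong_derivative F (F' t) t) \<and> has_nth_strong_derivative n F' D s)"


section \<open>Basic facts about the number operator\<close>

context
begin

interpretation C: vector_space "scaleC :: complex \<Rightarrow> 'a::chilbert_space \<Rightarrow> 'a"
  by (rule vector_space_scaleC)

lemma cinner_add_left: "cinner (x + y) z = cinner x z + cinner y (z::'a::chilbert_space)"
  by (metis cinner_add_right cinner_commute complex_cnj_add)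

lemma cinner_scaleC_left: "cinner (c *\<^sub>C x) y = cnj c * cinner x (y::'a::chilbert_space)"
  by (metis cinner_scaleC_right cinner_commute complex_cnj_mult)

lemma cinner_zero_right [simp]: "cinner x (0::'a::chilbert_space) = 0"
  using cinner_add_right[of x 0 0] by simp

lemma cinner_minus_right: "cinner x (- y) = - cinner x (y::'a::chilbert_space)"
  using cinner_add_right[of x y "- y"] by (simp add: eq_neg_iff_add_eq_0 add.commute)

lemma cinner_diff_right: "cinner x (y - z) = cinner x y - cinner x (z::'a::chilbert_space)"
  using cinner_add_right[of x y "- z"] by (simp add: cinner_minus_right)

lemma cinner_diff_left: "cinner (y - z) x = cinner y x - cinner z (x::'a::chilbert_space)"
  by (metis cinner_diff_right cinner_commute complex_cnj_diff)

lemma cinner_sum_right: "cinner x (sum f A) = (\<Sum>i\<in>A. cinner x (f i :: 'a::chilbert_space))"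
  by (induction A rule: infinite_finite_induct) (auto simp: cinner_add_right)

lemma cinner_self: "cinner x (x::'a::chilbert_space) = of_real ((norm x)\<^sup>2)"
proof -
  have "0 \<le> Re (cinner x x)"
    using norm_ge_zero[of x] unfolding norm_eq_sqrt_cinner by simp
  moreover have "Im (cinner x x) = 0"
    using cinner_commute[of x x] by (metis cnj.simps(2) equal_neg_zero)
  ultimately show ?thesis
    by (simp add: norm_eq_sqrt_cinner complex_eq_iff)
qed

lemma norm_scaleC: "norm (c *\<^sub>C x) = cmod c * norm (x::'a::chilbert_space)"
proof -
  have "(of_real ((norm (c *\<^sub>C x))\<^sup>2) :: complex) = (c * cnj c) * of_real ((norm x)\<^sup>2)"
    unfolding cinner_self[symmetric]
    by (simp add: cinner_scaleC_left cinner_scaleC_right)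
  also have "\<dots> = of_real ((cmod c * norm x)\<^sup>2)"
    by (simp add: power_mult_distrib flip: complex_norm_square)
  finally have "(of_real ((norm (c *\<^sub>C x))\<^sup>2) :: complex) = of_real ((cmod c * norm x)\<^sup>2)" .
  then have "(norm (c *\<^sub>C x))\<^sup>2 = (cmod c * norm x)\<^sup>2"
    by (simp only: of_real_eq_iff)
  then show ?thesis
    by (simp add: power2_eq_iff_nonneg)
qed

lemma norm_add_orthogonal:
  assumes "cinner x (y::'a::chilbert_space) = 0"
  shows "(norm (x + y))\<^sup>2 = (norm x)\<^sup>2 + (norm y)\<^sup>2"
proof -
  have "cinner y x = 0" using assms cinner_commute[of y x] by simp
  then have "(of_real ((norm (x + y))\<^sup>2) :: complex) = of_real ((norm x)\<^sup>2 + (norm y)\<^sup>2)"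
    unfolding of_real_add cinner_self[symmetric]
    using assms by (simp add: cinner_add_left cinner_add_right)
  then show ?thesis by (simp only: of_real_eq_iff)
qed

lemma Cauchy_Schwarz_cinner: "cmod (cinner x y) \<le> norm x * norm (y::'a::chilbert_space)"
proof (cases "x = 0")
  case True
  then show ?thesis using cinner_commute[of x y] by simp
next
  case False
  define c where "c = cinner x y / of_real ((norm x)\<^sup>2)"
  have "cinner (c *\<^sub>C x) (y - c *\<^sub>C x) = 0"
    using False by (simp add: cinner_scaleC_left cinner_diff_right cinner_scaleC_right
        cinner_self[of x] c_def)
  from norm_add_orthogonal[OF this] have "(norm (c *\<^sub>C x))\<^sup>2 \<le> (norm y)\<^sup>2"
    by simp
  then have "norm (c *\<^sub>C x) \<le> norm y"
    by (rule power2_le_imp_le) simp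
  moreover have "norm (c *\<^sub>C x) = cmod (cinner x y) / norm x"
    using False by (simp add: norm_scaleC c_def norm_divide norm_mult power2_eq_square)
  ultimately show ?thesis
    using False by (simp add: field_simps)
qed

lemma bounded_linear_cinner_right: "bounded_linear (cinner (x::'a::chilbert_space))"
  by (rule bounded_linear_intro[where K = "norm x"])
    (auto simp: cinner_add_right scaleR_scaleC cinner_scaleC_right mult.commute[of "norm _" "norm x"]
      intro: Cauchy_Schwarz_cinner simp flip: scaleR_conv_of_real)

lemma orthonormal_basis_expansion:
  fixes e :: "nat \<Rightarrow> 'a::chilbert_space"
  assumes e: "orthonormal_basis e"
  shows "(\<lambda>n. cinner (e n) x *\<^sub>C e n) sums x"
proof -
  define S where "S m v = (\<Sum>n<m. cinner (e n) v *\<^sub>C e n)" for m v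
  have on: "cinner (e m) (e n) = (if m = n then 1 else 0)" for m n
    using e by (simp add: orthonormal_basis_def)
  have S_add: "S m (u + v) = S m u + S m v" for m u v
    by (simp add: S_def cinner_add_right scaleC_add_left sum.distrib)
  have S_scale: "S m (c *\<^sub>C v) = c *\<^sub>C S m v" for m c v
    by (simp add: S_def cinner_scaleC_right C.scale_sum_right)
  have S_le: "norm (v - S m v) \<le> norm v" for m v
  proof -
    have "cinner (e k) (S m v) = cinner (e k) v" if "k < m" for k
      using that by (simp add: S_def cinner_sum_right cinner_scaleC_right on if_distrib cong: if_cong)
    then have "cinner (v - S m v) (e k) = 0" if "k < m" for k
      using that cinner_commute[of "v - S m v" "e k"] by (simp add: cinner_diff_right)
    then have "cinner (v - S m v) (S m v) = 0"
      by (subst (2) S_def) (simp add: cinner_sum_right cinner_scaleC_right)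
    from norm_add_orthogonal[OF this] have "(norm (v - S m v))\<^sup>2 \<le> (norm v)\<^sup>2"
      by simp
    then show ?thesis by (rule power2_le_imp_le) simp
  qed
  have S_span: "\<exists>M. \<forall>m\<ge>M. S m v = v" if "v \<in> cspan (range e)" for v
    using that unfolding cspan_def
  proof (induction rule: C.span_induct_alt)
    case base
    then show ?case by (simp add: S_def)
  next
    case (step c b v)
    from step(1) obtain k where k: "b = e k" by auto
    from step(2) obtain M where M: "\<forall>m\<ge>M. S m v = v" by auto
    have "S m (e k) = e k" if "m > k" for m
      using that by (simp add: S_def on if_distrib[of "\<lambda>c. c *\<^sub>C _"] cong: if_cong)
    then have "\<forall>m\<ge>max M (Suc k). S m (c *\<^sub>C b + v) = c *\<^sub>C b + v"
      using M by (simp add: S_add S_scale k)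
    then show ?case by blast
  qed
  have "(\<lambda>m. S m x) \<longlonglongrightarrow> x"
  proof (rule LIMSEQ_I)
    fix r :: real assume "0 < r"
    have "x \<in> closure (cspan (range e))"
      using e by (simp add: orthonormal_basis_def)
    then obtain y where y: "y \<in> cspan (range e)" "norm (y - x) < r"
      using \<open>0 < r\<close> by (metis closure_approachable dist_norm)
    obtain M where M: "\<forall>m\<ge>M. S m y = y" using S_span[OF y(1)] by blast
    have "norm (S m x - x) < r" if "m \<ge> M" for m
    proof -
      have "S m x = S m (x - y) + S m y"
        by (simp flip: S_add)
      then have "S m x - x = - ((x - y) - S m (x - y))"
        using M that by simp
      then have "norm (S m x - x) \<le> norm (x - y)"
        using S_le[of "x - y" m] by (simp only: norm_minus_cancel)
      then show ?thesis using y(2) by (simp add: norm_minus_commute)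
    qed
    then show "\<exists>M. \<forall>m\<ge>M. norm (S m x - x) < r" by blast
  qed
  then show ?thesis by (simp add: sums_def S_def)
qed

lemma cinner_number_op_of:
  fixes e :: "nat \<Rightarrow> 'a::chilbert_space"
  assumes "orthonormal_basis e" "(x, y) \<in> number_op_of e"
  shows "cinner (e m) y = of_nat m * cinner (e m) x"
proof -
  have on: "cinner (e m) (e n) = (if m = n then 1 else 0)" for m n
    using assms(1) by (simp add: orthonormal_basis_def)
  have "(\<lambda>n. cinner (e m) ((of_nat n * cinner (e n) x) *\<^sub>C e n)) sums cinner (e m) y"
    using assms(2) unfolding number_op_of_def
    by (auto intro: bounded_linear.sums[OF bounded_linear_cinner_right])
  moreover have "(\<lambda>n. cinner (e m) ((of_nat n * cinner (e n) x) *\<^sub>C e n)) =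
      (\<lambda>n. if n = m then of_nat n * cinner (e n) x else 0)"
    by (auto simp: cinner_scaleC_right on)
  ultimately show ?thesis
    using sums_single[of m "\<lambda>n. of_nat n * cinner (e n) x"] sums_unique2 by fastforce
qed

lemma number_op_of_iff:
  fixes e :: "nat \<Rightarrow> 'a::chilbert_space"
  assumes "orthonormal_basis e"
  shows "(x, y) \<in> number_op_of e \<longleftrightarrow> (\<forall>m. cinner (e m) y = of_nat m * cinner (e m) x)"
  using cinner_number_op_of[OF assms] orthonormal_basis_expansion[OF assms, of y]
  by (auto simp: number_op_of_def)

lemma number_op_of_basis:
  fixes e :: "nat \<Rightarrow> 'a::chilbert_space"
  assumes "orthonormal_basis e"
  shows "(e n, of_nat n *\<^sub>C e n) \<in> number_op_of e"
  unfolding number_op_of_iff[OF assms]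
  using assms by (simp add: orthonormal_basis_def cinner_scaleC_right)

proposition self_adjoint_number_op_of:
  fixes e :: "nat \<Rightarrow> 'a::chilbert_space"
  assumes e: "orthonormal_basis e"
  shows "self_adjoint (number_op_of e)"
  unfolding self_adjoint_def
proof
  have "C.subspace (Domain (number_op_of e))"
  proof (rule C.subspaceI)
    show "0 \<in> Domain (number_op_of e)"
      by (rule DomainI[of _ 0]) (simp add: number_op_of_iff[OF e])
  next
    fix u v assume "u \<in> Domain (number_op_of e)" "v \<in> Domain (number_op_of e)"
    then obtain u' v' where "(u, u') \<in> number_op_of e" "(v, v') \<in> number_op_of e" by auto
    then have "(u + v, u' + v') \<in> number_op_of e"
      by (simp add: number_op_of_iff[OF e] cinner_add_right algebra_simps)
    then show "u + v \<in> Domain (number_op_of e)" by blast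
  next
    fix c u assume "u \<in> Domain (number_op_of e)"
    then obtain u' where "(u, u') \<in> number_op_of e" by auto
    then have "(c *\<^sub>C u, c *\<^sub>C u') \<in> number_op_of e"
      by (simp add: number_op_of_iff[OF e] cinner_scaleC_right)
    then show "c *\<^sub>C u \<in> Domain (number_op_of e)" by blast
  qed
  moreover have "range e \<subseteq> Domain (number_op_of e)"
    using number_op_of_basis[OF e] by blast
  ultimately have "cspan (range e) \<subseteq> Domain (number_op_of e)"
    unfolding cspan_def by (intro C.span_minimal)
  from closure_mono[OF this] show "closure (Domain (number_op_of e)) = UNIV"
    using e by (auto simp: orthonormal_basis_def)
next
  show "adjoint_op (number_op_of e) = number_op_of e"
  proof (intro set_eqI iffI; clarify)
    fix x y assume "(x, y) \<in> adjoint_op (number_op_of e)"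
    then have "cinner x (of_nat n *\<^sub>C e n) = cinner y (e n)" for n
      using number_op_of_basis[OF e, of n] by (auto simp: adjoint_op_def)
    then have "cinner (e n) y = of_nat n * cinner (e n) x" for n
      using cinner_commute[of "e n" x] cinner_commute[of "e n" y]
      by (metis cinner_scaleC_right complex_cnj_mult complex_cnj_of_nat)
    then show "(x, y) \<in> number_op_of e" by (simp add: number_op_of_iff[OF e])
  next
    fix x y assume xy: "(x, y) \<in> number_op_of e"
    have "cinner x v = cinner y u" if uv: "(u, v) \<in> number_op_of e" for u v
    proof -
      have "(\<lambda>n. cinner x (cinner (e n) v *\<^sub>C e n)) sums cinner x v"
        by (rule bounded_linear.sums[OF bounded_linear_cinner_right orthonormal_basis_expansion[OF e]])
      moreover have "(\<lambda>n. cinner y (cinner (e n) u *\<^sub>C e n)) sums cinner y u"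
        by (rule bounded_linear.sums[OF bounded_linear_cinner_right orthonormal_basis_expansion[OF e]])
      moreover have "cinner x (cinner (e n) v *\<^sub>C e n) = cinner y (cinner (e n) u *\<^sub>C e n)" for n
        using cinner_number_op_of[OF e uv, of n] cinner_number_op_of[OF e xy, of n]
          cinner_commute[of x "e n"] cinner_commute[of y "e n"]
        by (simp add: cinner_scaleC_right)
      ultimately show ?thesis by (simp add: sums_unique2)
    qed
    then show "(x, y) \<in> adjoint_op (number_op_of e)" by (auto simp: adjoint_op_def)
  qed
qed

proposition eigenspace_number_op_of:
  fixes e :: "nat \<Rightarrow> 'a::chilbert_space"
  assumes e: "orthonormal_basis e"
  shows "eigenspace (number_op_of e) (of_nat n) = cspan {e n}"
proof (intro set_eqI iffI)
  fix x assume "x \<in> eigenspace (number_op_of e) (of_nat n)"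
  then have "of_nat n * cinner (e m) x = of_nat m * cinner (e m) x" for m
    by (simp add: eigenspace_def number_op_of_iff[OF e] cinner_scaleC_right)
  then have "cinner (e m) x = 0" if "m \<noteq> n" for m
    using that by (metis mult_right_cancel of_nat_eq_iff)
  then have "(\<lambda>m. cinner (e m) x *\<^sub>C e m) = (\<lambda>m. if m = n then cinner (e m) x *\<^sub>C e m else 0)"
    by auto
  then have "x = cinner (e n) x *\<^sub>C e n"
    using orthonormal_basis_expansion[OF e, of x] sums_single[of n "\<lambda>m. cinner (e m) x *\<^sub>C e m"]
    by (metis sums_unique2)
  then show "x \<in> cspan {e n}"
    unfolding cspan_def by (metis C.span_base C.span_scale singletonI)
next
  fix x assume "x \<in> cspan {e n}"
  then obtain c where "x = c *\<^sub>C e n"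
    unfolding cspan_def C.span_singleton by auto
  then show "x \<in> eigenspace (number_op_of e) (of_nat n)"
    using e by (simp add: eigenspace_def number_op_of_iff[OF e] cinner_scaleC_right orthonormal_basis_def)
qed

end

end

theory Submission
  imports
    Defs
    "HOL-Probability.Characteristic_Functions"
    "HOL-Complex_Analysis.Cauchy_Integral_Formula"
begin

text \<open>
  The vectors \<open>e\<^bsup>|z|\<^sup>2/2\<^esup> W(z)\<Omega>\<close> depend holomorphically on \<open>z\<close>, form a total set and have inner
  products \<open>e\<^bsup>cnj(z) w\<^esup>\<close>. Their Taylor coefficients at 0 give the number basis, and \<open>s\<^sup>N\<close> maps the vector
  of \<open>z\<close> to the vector of \<open>s z\<close>. Since a Weyl operator maps such a vector to a multiple of another
  one, the matrix elements of the integral between two of them are Gaussian integrals over the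
  plane; totality and dominated convergence extend the identity to all of the Hilbert space.
  The derivatives of \<open>s\<^sup>N\<close> are obtained by differentiating the series \<open>\<Sum> s\<^sup>n P\<^sub>n\<close> term by term.
\<close>

section \<open>Gaussian integrals and Taylor coefficients\<close>

text \<open>The characteristic function of the standard normal distribution, moved from that
  probability measure to its density against Lebesgue measure.\<close>

lemma has_bochner_integral_std_normal_iexp:
  "has_bochner_integral lborel
     (\<lambda>x. of_real (std_normal_density x) * exp (\<i> * of_real (t * x))) (of_real (exp (- (t^2) / 2)) :: complex)"
proof -
  interpret real_distribution std_normal_distribution
    by (rule real_dist_normal_dist)
  have "integrable std_normal_distribution (\<lambda>x. exp (\<i> * complex_of_real (t * x)))"
    by (rule integrable_const_bound[where B = 1]) auto
  moreover have "(LINT x|std_normal_distribution. exp (\<i> * complex_of_real (t * x))) = of_real (exp (- (t^2) / 2))"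
    using char_std_normal_distribution by (simp add: char_def fun_eq_iff)
  ultimately have "has_bochner_integral std_normal_distribution (\<lambda>x. exp (\<i> * complex_of_real (t * x)))
      (of_real (exp (- (t^2) / 2)))"
    by (simp add: has_bochner_integral_iff)
  then show ?thesis
    by (simp add: has_bochner_integral_iff integrable_density integral_density scaleR_conv_of_real)
qed

text \<open>With \<open>b = p + \<i> q\<close>, the square is completed for \<open>p\<close> alone,
  by a real substitution. The part \<open>q\<close> becomes the frequency in the characteristic
  function of the standard normal, so no contour has to be shifted.\<close>

lemma has_bochner_integral_gaussian:
  fixes a :: real and b :: complex
  assumes "a > 0"
  shows "has_bochner_integral lborel (\<lambda>x::real. exp (- of_real (a * x\<^sup>2) + b * of_real x))
    (of_real (sqrt (pi / a)) * exp (b\<^sup>2 / of_real (4 * a)))"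
proof -
  define c where "c = sqrt (2 * a)"
  have c: "c > 0" "c\<^sup>2 = 2 * a" using assms by (auto simp: c_def)
  define p q where "p = Re b" and "q = Im b"
  have b: "b = of_real p + \<i> * of_real q" by (simp add: p_def q_def complex_eq_iff)
  \<comment> \<open>\<open>K\<close> undoes three factors produced by
    \<open>x \<mapsto> - p / c + c * x\<close>: the normalisation of the density, the constant
    \<open>exp (- p^2 / (4 * a))\<close> from the square, and the phase that the shift by
    \<open>- p / c\<close> causes in the character.\<close>
  define K where "K = of_real (sqrt (2 * pi)) * exp (of_real (p\<^sup>2 / (4 * a)) + \<i> * of_real (p * q / (2 * a)))"
  let ?f = "\<lambda>x. of_real (std_normal_density x) * exp (\<i> * of_real ((q / c) * x)) :: complex"
  have "has_bochner_integral lborel (\<lambda>x. ?f (- p / c + c * x)) (of_real (exp (- ((q / c)^2) / 2)) /\<^sub>R \<bar>c\<bar>)"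
    using has_bochner_integral_std_normal_iexp[of "q / c"] c
    by (subst (asm) lborel_has_bochner_integral_real_affine_iff[where c = c and t = "- p / c"]) auto
  then have "has_bochner_integral lborel (\<lambda>x. K * ?f (- p / c + c * x))
      (K * (of_real (exp (- ((q / c)^2) / 2)) /\<^sub>R \<bar>c\<bar>))"
    by (rule has_bochner_integral_mult_right)
  moreover have "K * ?f (- p / c + c * x) = exp (- of_real (a * x\<^sup>2) + b * of_real x)" for x
  proof -
    have sq: "(- p / c + c * x)\<^sup>2 = p\<^sup>2 / (2 * a) - 2 * p * x + 2 * a * x\<^sup>2"
    proof -
      have "(- p / c + c * x)\<^sup>2 = p\<^sup>2 / c\<^sup>2 - 2 * p * x + c\<^sup>2 * x\<^sup>2"
        using c(1) by (simp add: power2_eq_square field_simps)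
      then show ?thesis by (simp only: c(2))
    qed
    have lin: "(q / c) * (- p / c + c * x) = q * x - p * q / (2 * a)"
      using c(1) unfolding c(2)[symmetric] by (simp add: field_simps power2_eq_square)
    have "K * ?f (- p / c + c * x) = exp (of_real (p\<^sup>2 / (4 * a)) + \<i> * of_real (p * q / (2 * a)))
        * exp (of_real (- (- p / c + c * x)\<^sup>2 / 2)) * exp (\<i> * of_real ((q / c) * (- p / c + c * x)))"
      by (simp add: K_def std_normal_density_def flip: exp_of_real)
    also have "\<dots> = exp (- of_real (a * x\<^sup>2) + b * of_real x)"
      unfolding sq lin exp_add[symmetric] using assms
      by (intro arg_cong[where f = exp]) (simp add: b complex_eq_iff field_simps)
    finally show ?thesis .
  qed
  moreover have "K * (of_real (exp (- ((q / c)^2) / 2)) /\<^sub>R \<bar>c\<bar>) = of_real (sqrt (pi / a)) * exp (b\<^sup>2 / of_real (4 * a))"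
  proof -
    have 1: "sqrt (2 * pi) / c = sqrt (pi / a)"
      using assms by (simp add: c_def real_sqrt_mult real_sqrt_divide)
    have b2: "b\<^sup>2 = of_real (p\<^sup>2 - q\<^sup>2) + \<i> * of_real (2 * p * q)"
      by (simp add: b power2_sum power_mult_distrib)
    have qc: "(q / c)\<^sup>2 = q\<^sup>2 / (2 * a)"
      by (simp only: power_divide c(2))
    have 2: "of_real (p\<^sup>2 / (4 * a)) + \<i> * of_real (p * q / (2 * a)) + of_real (- ((q / c)^2) / 2) = b\<^sup>2 / of_real (4 * a)"
      unfolding b2 qc using assms by (simp add: field_simps)
    have divc: "of_real x /\<^sub>R \<bar>c\<bar> = (of_real x / of_real c :: complex)" for x
      using c by (simp add: scaleR_conv_of_real divide_inverse mult.commute)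
    have "K * (of_real (exp (- ((q / c)^2) / 2)) /\<^sub>R \<bar>c\<bar>) = of_real (sqrt (2 * pi) / c) *
      (exp (of_real (p\<^sup>2 / (4 * a)) + \<i> * of_real (p * q / (2 * a))) * exp (of_real (- ((q / c)^2) / 2)))"
      unfolding divc K_def exp_of_real[of "- _ / 2"] by (simp only: of_real_mult of_real_inverse of_real_divide divide_inverse mult_ac)
    also have "\<dots> = of_real (sqrt (pi / a)) * exp (b\<^sup>2 / of_real (4 * a))"
      unfolding 1 exp_add[symmetric] 2 ..
    finally show ?thesis .
  qed
  ultimately show ?thesis by simp
qed

text \<open>For \<open>z = x + \<i> y\<close> the linear part is
  \<open>(b + c) x + \<i> (b - c) y\<close>, so the integral is a product of two line integrals, and
  \<open>(b + c)^2 + (\<i> (b - c))^2 = 4 b c\<close>.\<close>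

lemma has_bochner_integral_gaussian_complex:
  fixes a :: real and b c :: complex
  assumes "a > 0"
  shows "has_bochner_integral lborel (\<lambda>z. exp (- of_real (a * (cmod z)\<^sup>2) + b * z + c * cnj z))
    (of_real (pi / a) * exp (b * c / of_real a))"
proof -
  \<comment> \<open>The coordinates are indexed by \<open>Basis\<close>, that is by \<open>1\<close>
    and \<open>\<i>\<close>; the case distinction selects the coefficient of the real or the
    imaginary coordinate.\<close>
  define h where "h i x = (exp (- of_real (a * x\<^sup>2) + (if i = 1 then b + c else \<i> * (b - c)) * of_real x))"
    for i :: complex and x :: real
  let ?g = "\<lambda>z. exp (- of_real (a * (cmod z)\<^sup>2) + b * z + c * cnj z)"
  interpret product_sigma_finite "\<lambda>_::complex. lborel :: real measure" ..
  have h: "has_bochner_integral lborel (h i) (of_real (sqrt (pi / a)) *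
      exp ((if i = 1 then b + c else \<i> * (b - c))\<^sup>2 / of_real (4 * a)))" for i
    unfolding h_def using has_bochner_integral_gaussian[OF assms] .
  have gh: "?g (\<Sum>i\<in>Basis. f i *\<^sub>R i) = (\<Prod>i\<in>Basis. h i (f i))" for f
    by (simp add: Basis_complex_def h_def cmod_power2 flip: exp_add)
      (simp add: algebra_simps complex_eq_iff scaleR_conv_of_real)
  have "has_bochner_integral (Pi\<^sub>M Basis (\<lambda>_. lborel)) (\<lambda>f. \<Prod>i\<in>Basis. h i (f i))
     (\<Prod>i\<in>Basis. integral\<^sup>L lborel (h i))"
    using h by (simp add: has_bochner_integral_iff product_integral_prod product_integrable_prod)
  also have "(\<Prod>i\<in>Basis. integral\<^sup>L lborel (h i)) =
      of_real (sqrt (pi / a)) * of_real (sqrt (pi / a)) *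
      exp ((b + c)\<^sup>2 / of_real (4 * a) + (\<i> * (b - c))\<^sup>2 / of_real (4 * a))"
    using h by (simp add: has_bochner_integral_iff Basis_complex_def exp_add)
  also have "of_real (sqrt (pi / a)) * of_real (sqrt (pi / a)) = complex_of_real (pi / a)"
    using assms by (simp flip: of_real_mult)
  also have "(b + c)\<^sup>2 / of_real (4 * a) + (\<i> * (b - c))\<^sup>2 / of_real (4 * a) = b * c / of_real a"
    using assms by (simp add: field_simps power2_eq_square)
  finally have int: "has_bochner_integral (Pi\<^sub>M Basis (\<lambda>_. lborel)) (\<lambda>f. ?g (\<Sum>i\<in>Basis. f i *\<^sub>R i))
      (of_real (pi / a) * exp (b * c / of_real a))"
    by (simp only: gh)
  \<comment> \<open>Lebesgue measure on the plane is the image of the product measure under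
    \<open>f \<mapsto> \<Sum>i\<in>Basis. f i *\<^sub>R i\<close>; measurability of this map and of
    \<open>?g\<close> lets the integral be transferred.\<close>
  have "?g \<in> borel_measurable borel"
    by (intro borel_measurable_continuous_onI continuous_intros)
  moreover have "(\<lambda>f. \<Sum>i\<in>Basis. f i *\<^sub>R i :: complex) \<in> borel_measurable (Pi\<^sub>M Basis (\<lambda>_. lborel))"
    by (intro borel_measurable_sum borel_measurable_scaleR) auto
  ultimately show ?thesis
    using int by (subst lborel_eq) (rule has_bochner_integral_distr)
qed

text \<open>Cauchy's formula on the unit circle, parametrised over \<open>{0..1}\<close>. It is used
  to read off coefficients of scalar functions
  \<open>z \<mapsto> cinner x (exp_vec z)\<close>.\<close>

lemma has_integral_circle_power_series:
  fixes a :: "nat \<Rightarrow> complex"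
  assumes sums: "\<And>z. (\<lambda>k. a k * z ^ k) sums f z"
  shows "((\<lambda>t. f (exp (2 * of_real pi * \<i> * of_real t)) / exp (2 * of_real pi * \<i> * of_real t) ^ n)
    has_integral a n) {0..1}"
proof -
  have "f has_fps_expansion Abs_fps a"
    using sums by (intro has_fps_expansionI) simp
  then have an: "a n = (deriv ^^ n) f 0 / fact n"
    using fps_nth_fps_expansion[of f "Abs_fps a" n] by simp
  have "f holomorphic_on ball 0 r" for r
    using sums by (intro power_series_holomorphic[where a = a and z = 0]) simp
  then have hol: "f holomorphic_on ball 0 1" "continuous_on (cball 0 1) f"
    using holomorphic_on_imp_continuous_on[of f "ball 0 2"] by (auto elim!: continuous_on_subset)
  have "((\<lambda>u. f u / (u - 0) ^ Suc n) has_contour_integral (2 * pi * \<i>) / fact n * (deriv ^^ n) f 0) (circlepath 0 1)"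
    by (rule Cauchy_has_contour_integral_higher_derivative_circlepath) (use hol in auto)
  then have "((\<lambda>t. f (circlepath 0 1 t) / (circlepath 0 1 t - 0) ^ Suc n * vector_derivative (circlepath 0 1) (at t))
      has_integral (2 * pi * \<i>) * a n) {0..1}"
    by (simp add: has_contour_integral an)
  \<comment> \<open>The derivative of the path supplies \<open>2 * pi * \<i>\<close> and one factor
    \<open>exp (2 * pi * \<i> * t)\<close>, which lowers the exponent from \<open>Suc n\<close> to
    \<open>n\<close>.\<close>
  moreover have "f (circlepath 0 1 t) / (circlepath 0 1 t - 0) ^ Suc n * vector_derivative (circlepath 0 1) (at t) =
      (2 * pi * \<i>) * (f (exp (2 * of_real pi * \<i> * of_real t)) / exp (2 * of_real pi * \<i> * of_real t) ^ n)" for t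
    unfolding vector_derivative_circlepath by (simp add: circlepath)
  ultimately have "((\<lambda>t. (2 * pi * \<i>) * (f (exp (2 * of_real pi * \<i> * of_real t)) / exp (2 * of_real pi * \<i> * of_real t) ^ n))
      has_integral (2 * pi * \<i>) * a n) {0..1}"
    by simp
  from has_integral_mult_right[OF this, of "inverse (2 * pi * \<i>)"] show ?thesis
    by (simp add: field_simps)
qed

section \<open>Complex Hilbert spaces\<close>

lemma scaleC_one [simp]: "1 *\<^sub>C x = (x::'a::chilbert_space)"
  using scaleR_scaleC[of 1 x] by simp

lemma scaleC_zero_left [simp]: "0 *\<^sub>C x = (0::'a::chilbert_space)"
  using scaleR_scaleC[of 0 x] by simp

lemma bounded_bilinear_scaleC: "bounded_bilinear (scaleC :: complex \<Rightarrow> 'a::chilbert_space \<Rightarrow> 'a)"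
proof
  show "\<exists>K. \<forall>a b. norm (a *\<^sub>C (b::'a)) \<le> norm a * norm b * K"
    by (rule exI[of _ 1]) (simp add: norm_scaleC)
qed (simp_all add: scaleC_add_left scaleC_add_right scaleR_scaleC scaleC_scaleC mult_ac
       scaleR_conv_of_real)

lemma bounded_clinearI:
  assumes "\<And>x y. T (x + y) = T x + T y" "\<And>c x. T (c *\<^sub>C x) = c *\<^sub>C T x"
    and "\<And>x. norm (T x) \<le> norm x * K"
  shows "bounded_clinear T"
  unfolding bounded_clinear_def
  using assms by (auto intro!: bounded_linear_intro[where K = K] simp: scaleR_scaleC)

lemma bounded_clinear_scaleR:
  assumes "bounded_clinear T"
  shows "bounded_clinear (\<lambda>x. r *\<^sub>R T x)"
proof -
  have "bounded_linear (\<lambda>x. r *\<^sub>R T x)"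
    using assms unfolding bounded_clinear_def
    by (intro bounded_linear_compose[OF bounded_linear_scaleR_right]) auto
  then show ?thesis
    using assms by (simp add: bounded_clinear_def scaleR_scaleC scaleC_scaleC mult.commute)
qed

text \<open>The density argument as an induction rule: every vector is the limit of a sequence from
  the span, so stability under linear combinations and sequential limits suffices.\<close>

lemma cspan_closure_induct [consumes 1, case_names scale_add closed zero base]:
  assumes total: "closure (cspan S) = UNIV"
    and scale_add: "\<And>c x y. P x \<Longrightarrow> P y \<Longrightarrow> P (c *\<^sub>C x + y)"
    and closed: "\<And>f x. (\<And>n::nat. P (f n)) \<Longrightarrow> f \<longlonglongrightarrow> x \<Longrightarrow> P x"
    and base: "P 0" "\<And>x. x \<in> S \<Longrightarrow> P x"
  shows "P x"
proof -
  interpret C: vector_space "scaleC :: complex \<Rightarrow> 'a \<Rightarrow> 'a"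
    by (rule vector_space_scaleC)
  have span: "P y" if "y \<in> cspan S" for y
    using that unfolding cspan_def
    by (induction rule: C.span_induct_alt) (auto intro: scale_add base)
  have "x \<in> closure (cspan S)" using total by simp
  then obtain f where "\<And>n::nat. f n \<in> cspan S" "f \<longlonglongrightarrow> x"
    unfolding closure_sequential by blast
  then show ?thesis using span closed by blast
qed

text \<open>Evaluates the \<open>THE\<close> in \<open>orth_proj\<close>: a candidate is
  \<open>c *\<^sub>C e\<close>, and orthogonality of the remainder to \<open>e\<close> forces the
  value of \<open>c\<close>.\<close>

lemma orth_proj_cspan_singleton:
  assumes "cinner e e = 1"
  shows "orth_proj (cspan {e}) x = cinner e x *\<^sub>C (e::'a::chilbert_space)"
proof -
  interpret C: vector_space "scaleC :: complex \<Rightarrow> 'a \<Rightarrow> 'a"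
    by (rule vector_space_scaleC)
  show ?thesis
    unfolding orth_proj_def
  proof (rule the_equality)
    show "cinner e x *\<^sub>C e \<in> cspan {e} \<and> (\<forall>m\<in>cspan {e}. cinner m (x - cinner e x *\<^sub>C e) = 0)"
      using assms by (auto simp: cspan_def C.span_singleton cinner_scaleC_left cinner_diff_right cinner_scaleC_right)
  next
    fix p assume p: "p \<in> cspan {e} \<and> (\<forall>m\<in>cspan {e}. cinner m (x - p) = 0)"
    then obtain c where c: "p = c *\<^sub>C e" by (auto simp: cspan_def C.span_singleton)
    have "e \<in> cspan {e}" by (simp add: cspan_def C.span_base)
    with p have "cinner e (x - p) = 0" by blast
    then have "c = cinner e x"
      using assms by (simp add: c cinner_diff_right cinner_scaleC_right)
    with c show "p = cinner e x *\<^sub>C e" by simp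
  qed
qed

lemma unitary_norm: "unitary U \<Longrightarrow> norm (U x) = norm x"
  by (simp add: unitary_def norm_eq_sqrt_cinner)

text \<open>Pythagoras: the remainder is orthogonal to each \<open>e k\<close> with
  \<open>k < m\<close>, hence to the partial sum.\<close>

lemma norm_minus_orthonormal_sum:
  fixes e :: "nat \<Rightarrow> 'a::chilbert_space"
  assumes on: "\<And>m n. cinner (e m) (e n) = (if m = n then 1 else 0)"
  shows "(norm (x - (\<Sum>n<m. cinner (e n) x *\<^sub>C e n)))\<^sup>2 = (norm x)\<^sup>2 - (\<Sum>n<m. (cmod (cinner (e n) x))\<^sup>2)"
proof -
  define S where "S = (\<Sum>n<m. cinner (e n) x *\<^sub>C e n)"
  have left: "cinner v S = (\<Sum>n<m. cinner (e n) x * cinner v (e n))" for v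
    by (simp add: S_def cinner_sum_right cinner_scaleC_right)
  have eS: "cinner (e k) S = cinner (e k) x" if "k < m" for k
    using that by (simp add: left on if_distrib cong: if_cong)
  have "cinner (x - S) S = 0"
    by (subst left, rule sum.neutral) (metis cinner_commute cinner_diff_right complex_cnj_zero diff_self eS lessThan_iff mult_zero_right)
  from norm_add_orthogonal[OF this] have *: "(norm x)\<^sup>2 = (norm (x - S))\<^sup>2 + (norm S)\<^sup>2"
    by simp
  have "complex_of_real ((norm S)\<^sup>2) = (\<Sum>n<m. cinner (e n) x * cnj (cinner (e n) x))"
    unfolding cinner_self[symmetric] left
    by (rule sum.cong) (use eS cinner_commute[of S] in auto)
  also have "\<dots> = of_real (\<Sum>n<m. (cmod (cinner (e n) x))\<^sup>2)"
    by (simp flip: complex_norm_square)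
  finally have "(norm S)\<^sup>2 = (\<Sum>n<m. (cmod (cinner (e n) x))\<^sup>2)"
    by (simp only: of_real_eq_iff)
  with * show ?thesis by (simp add: S_def)
qed

text \<open>Parseval's equality for the single vector \<open>x\<close> drives the norm of the
  remainder to 0. This expands exponential vectors before the orthonormal family is known to be
  total.\<close>

lemma orthonormal_sums_if_Parseval:
  fixes e :: "nat \<Rightarrow> 'a::chilbert_space"
  assumes on: "\<And>m n. cinner (e m) (e n) = (if m = n then 1 else 0)"
    and Parseval: "(\<lambda>n. (cmod (cinner (e n) x))\<^sup>2) sums (norm x)\<^sup>2"
  shows "(\<lambda>n. cinner (e n) x *\<^sub>C e n) sums x"
proof -
  have "(\<lambda>m. (norm x)\<^sup>2 - (\<Sum>n<m. (cmod (cinner (e n) x))\<^sup>2)) \<longlonglongrightarrow> (norm x)\<^sup>2 - (norm x)\<^sup>2"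
    using Parseval unfolding sums_def by (intro tendsto_intros)
  then have "(\<lambda>m. sqrt ((norm (x - (\<Sum>n<m. cinner (e n) x *\<^sub>C e n)))\<^sup>2)) \<longlonglongrightarrow> sqrt 0"
    by (intro tendsto_real_sqrt) (simp add: norm_minus_orthonormal_sum[OF on])
  then have "(\<lambda>m. norm ((\<Sum>n<m. cinner (e n) x *\<^sub>C e n) - x)) \<longlonglongrightarrow> 0"
    by (simp add: norm_minus_commute)
  then show ?thesis
    unfolding sums_def tendsto_norm_zero_iff by (rule LIM_zero_cancel)
qed

lemma closure_cspan_scale_add:
  fixes x y :: "'a::chilbert_space"
  assumes "x \<in> closure (cspan S)" "y \<in> closure (cspan S)"
  shows "c *\<^sub>C x + y \<in> closure (cspan S)"
proof -
  interpret C: vector_space "scaleC :: complex \<Rightarrow> 'a \<Rightarrow> 'a"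
    by (rule vector_space_scaleC)
  obtain f g where fg: "\<And>n::nat. f n \<in> cspan S" "f \<longlonglongrightarrow> x" "\<And>n::nat. g n \<in> cspan S" "g \<longlonglongrightarrow> y"
    using assms unfolding closure_sequential by blast
  have lim: "(\<lambda>n. c *\<^sub>C f n + g n) \<longlonglongrightarrow> c *\<^sub>C x + y"
    by (rule tendsto_add[OF bounded_bilinear.tendsto[OF bounded_bilinear_scaleC tendsto_const fg(2)] fg(4)])
  have "c *\<^sub>C f n + g n \<in> cspan S" for n
    using fg(1)[of n] fg(3)[of n] unfolding cspan_def by (rule C.span_add[OF C.span_scale])
  then show ?thesis
    by (intro closed_sequentially[OF closed_closure _ lim]) (use closure_subset in blast)
qed

section \<open>Strong derivatives of operator power series\<close>

text \<open>The majorant \<open>c\<close> makes the series absolutely convergent at each vector, and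
  \<open>suminf c\<close> serves as the operator bound.\<close>

lemma bounded_clinear_suminf:
  fixes A :: "nat \<Rightarrow> 'a::chilbert_space \<Rightarrow> 'b::chilbert_space"
  assumes A: "\<And>k. bounded_clinear (A k)"
    and bound: "\<And>k x. norm (A k x) \<le> c k * norm x" and c: "summable c"
  shows "bounded_clinear (\<lambda>x. \<Sum>k. A k x)"
proof -
  have sm: "summable (\<lambda>k. norm (A k x))" for x
    by (rule summable_comparison_test'[where g = "\<lambda>k. c k * norm x"])
      (use bound c in \<open>auto intro: summable_mult2\<close>)
  note sums = summable_sums[OF summable_norm_cancel[OF sm]]
  have A_add: "A k (x + y) = A k x + A k y" and A_scale: "A k (z *\<^sub>C x) = z *\<^sub>C A k x" for k x y z
    using A[of k] by (auto simp: bounded_clinear_def bounded_linear_def linear_add)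
  show ?thesis
  proof (rule bounded_clinearI)
    fix x y
    show "(\<Sum>k. A k (x + y)) = (\<Sum>k. A k x) + (\<Sum>k. A k y)"
      using sums_add[OF sums[of x] sums[of y]] by (simp add: A_add sums_iff)
    show "(\<Sum>k. A k (z *\<^sub>C x)) = z *\<^sub>C (\<Sum>k. A k x)" for z
      using bounded_linear.sums[OF bounded_bilinear.bounded_linear_right[OF bounded_bilinear_scaleC] sums[of x]]
      by (simp add: A_scale sums_iff)
    have "norm (\<Sum>k. A k x) \<le> (\<Sum>k. norm (A k x))"
      by (rule summable_norm[OF sm])
    also have "\<dots> \<le> (\<Sum>k. c k * norm x)"
      by (intro suminf_le sm summable_mult2 c bound)
    also have "\<dots> = norm x * suminf c"
      using suminf_mult2[OF c, of "norm x"] by (simp add: mult.commute)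
    finally show "norm (\<Sum>k. A k x) \<le> norm x * suminf c" .
  qed
qed

text \<open>Termwise differentiation, justified on a ball of radius \<open>r\<close> strictly
  between \<open>\<bar>t\<bar>\<close> and \<open>R\<close>, where the Weierstrass test makes the
  series of derivatives converge uniformly.\<close>

lemma has_vector_derivative_power_series:
  fixes v :: "nat \<Rightarrow> 'a::banach"
  assumes sm: "\<And>r::real. \<bar>r\<bar> < R \<Longrightarrow> summable (\<lambda>k. norm (v k) * r ^ k)"
    and t: "\<bar>t\<bar> < R"
  shows "((\<lambda>t. \<Sum>k. t ^ k *\<^sub>R v k) has_vector_derivative (\<Sum>k. t ^ k *\<^sub>R (real (Suc k) *\<^sub>R v (Suc k)))) (at t)"
proof -
  obtain r where r: "\<bar>t\<bar> < r" "r < R" using dense t by blast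
  then have r0: "0 < r" "\<bar>r\<bar> < R" by auto
  \<comment> \<open>The derivative of the \<open>k\<close>-th term; for \<open>k = 0\<close> the
    truncated exponent \<open>k - 1\<close> is harmless, because the factor \<open>real k\<close> is
    0.\<close>
  define g where "g k s = (real k * s ^ (k - 1)) *\<^sub>R v k" for k and s :: real
  have M: "summable (\<lambda>k. real k * r ^ (k - 1) * norm (v k))"
  proof -
    have "summable (\<lambda>k. diffs (\<lambda>k. norm (v k)) k * r ^ k)"
      by (rule termdiff_converges[where K = R]) (use r r0 sm in auto)
    then have "summable (\<lambda>k. real (Suc k) * r ^ (Suc k - 1) * norm (v (Suc k)))"
      by (simp add: diffs_def mult_ac)
    then show ?thesis by (subst (asm) summable_Suc_iff)
  qed
  have "uniform_limit (ball 0 r) (\<lambda>n s. \<Sum>k<n. g k s) (\<lambda>s. \<Sum>k. g k s) sequentially"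
    by (rule Weierstrass_m_test[OF _ M])
      (auto simp: g_def abs_mult power_abs intro!: mult_right_mono mult_left_mono power_mono)
  then have u: "\<forall>\<^sub>F n in sequentially. \<forall>s\<in>ball 0 r. norm ((\<Sum>k<n. g k s) - (\<Sum>k. g k s)) < \<epsilon>" if "\<epsilon> > 0" for \<epsilon>
    using that by (simp add: uniform_limit_iff dist_norm)
  have sums: "summable (\<lambda>k. s ^ k *\<^sub>R v k)" if "\<bar>s\<bar> < R" for s
    by (rule summable_norm_cancel) (use sm[of "\<bar>s\<bar>"] that in \<open>simp add: power_abs mult.commute\<close>)
  have "\<exists>G. \<forall>s\<in>ball 0 r. (\<lambda>k. s ^ k *\<^sub>R v k) sums G s \<and>
      (G has_derivative (\<lambda>h. h *\<^sub>R (\<Sum>k. g k s))) (at s within ball 0 r)"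
  proof (rule has_derivative_series[where f' = "\<lambda>k s h. h *\<^sub>R g k s"])
    show "((\<lambda>s. s ^ k *\<^sub>R v k) has_derivative (\<lambda>h. h *\<^sub>R g k s)) (at s within ball 0 r)" for k s
      unfolding g_def by (auto intro!: derivative_eq_intros)
    show "\<forall>\<^sub>F n in sequentially. \<forall>s\<in>ball 0 r. \<forall>h.
        norm ((\<Sum>k<n. h *\<^sub>R g k s) - h *\<^sub>R (\<Sum>k. g k s)) \<le> \<epsilon> * norm h" if "\<epsilon> > 0" for \<epsilon> :: real
      using u[OF that]
    proof eventually_elim
      case (elim n)
      have "norm ((\<Sum>k<n. h *\<^sub>R g k s) - h *\<^sub>R (\<Sum>k. g k s)) = norm ((\<Sum>k<n. g k s) - (\<Sum>k. g k s)) * norm h" for s h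
        by (simp add: mult.commute flip: scaleR_sum_right scaleR_diff_right)
      with elim show ?case
        by (simp only:) (intro ballI allI mult_right_mono, auto intro: less_imp_le)
    qed
    show "(\<lambda>k. 0 ^ k *\<^sub>R v k) sums (\<Sum>k. 0 ^ k *\<^sub>R v k)"
      using sums[of 0] r0 by (simp add: summable_sums)
  qed (use r0 in auto)
  then obtain G where G: "\<And>s. s \<in> ball 0 r \<Longrightarrow> (\<lambda>k. s ^ k *\<^sub>R v k) sums G s"
    "\<And>s. s \<in> ball 0 r \<Longrightarrow> (G has_derivative (\<lambda>h. h *\<^sub>R (\<Sum>k. g k s))) (at s within ball 0 r)"
    by blast
  have "((\<lambda>t. \<Sum>k. t ^ k *\<^sub>R v k) has_vector_derivative (\<Sum>k. g k t)) (at t)"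
    unfolding has_vector_derivative_def
  proof (rule has_derivative_transform_within_open[where s = "ball 0 r" and f = G])
    show "(G has_derivative (\<lambda>h. h *\<^sub>R (\<Sum>k. g k t))) (at t)"
      using G(2)[of t] r by (simp add: at_within_open[OF _ open_ball])
  qed (use r G(1) in \<open>auto simp: sums_iff\<close>)
  \<comment> \<open>The term \<open>k = 0\<close> vanishes, so splitting it off only shifts the
    index.\<close>
  moreover have "(\<Sum>k. g k t) = (\<Sum>k. t ^ k *\<^sub>R (real (Suc k) *\<^sub>R v (Suc k)))"
  proof -
    have "summable (\<lambda>k. g k t)"
      by (rule summable_comparison_test'[OF M, where N = 0])
        (use r in \<open>auto simp: g_def abs_mult power_abs intro!: mult_right_mono mult_left_mono power_mono\<close>)
    from suminf_split_head[OF this] show ?thesis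
      by (simp add: g_def mult_ac)
  qed
  ultimately show ?thesis by simp
qed

text \<open>The derivative of an operator power series is another one with the same
  \<open>R\<close>, so the induction on \<open>n\<close> keeps the coefficients \<open>A\<close> and
  their bounds \<open>c\<close> arbitrary.\<close>

lemma has_nth_strong_derivative_power_series:
  fixes A :: "nat \<Rightarrow> 'a::chilbert_space \<Rightarrow> 'a"
  assumes "\<And>k. bounded_clinear (A k)"
    and "\<And>k x. norm (A k x) \<le> c k * norm x"
    and "\<And>r::real. \<bar>r\<bar> < R \<Longrightarrow> summable (\<lambda>k. c k * r ^ k)" and "R > 0"
  shows "has_nth_strong_derivative n (\<lambda>t x. \<Sum>k. t ^ k *\<^sub>R A k x) (\<lambda>x. fact n *\<^sub>R A n x) 0"
  using assms(1-3)
proof (induction n arbitrary: A c)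
  case 0
  \<comment> \<open>Only the term \<open>k = 0\<close> survives at the origin, since
    \<open>0 ^ 0 = 1\<close>.\<close>
  have "(\<Sum>k. 0 ^ k *\<^sub>R A k x) = (\<Sum>k\<in>{0}. 0 ^ k *\<^sub>R A k x)" for x
    by (rule suminf_finite) auto
  then show ?case by simp
next
  case (Suc n)
  define A' where "A' k x = real (Suc k) *\<^sub>R A (Suc k) x" for k x
  define c' where "c' k = real (Suc k) * c (Suc k)" for k
  have A': "bounded_clinear (A' k)" for k
    unfolding A'_def by (intro bounded_clinear_scaleR Suc.prems)
  have c'_bound: "norm (A' k x) \<le> c' k * norm x" for k x
    using mult_left_mono[OF Suc.prems(2)[of "Suc k" x], of "real (Suc k)"]
    by (simp add: A'_def c'_def mult_ac)
  have c'_summable: "summable (\<lambda>k. c' k * r ^ k)" if "\<bar>r\<bar> < R" for r :: real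
    using termdiff_converges[where K = R and c = c and x = r] Suc.prems(3) that
    by (simp add: c'_def diffs_def)
  have "has_nth_strong_derivative n (\<lambda>t x. \<Sum>k. t ^ k *\<^sub>R A' k x) (\<lambda>x. fact n *\<^sub>R A' n x) 0"
    using A' c'_bound c'_summable by (rule Suc.IH)
  \<comment> \<open>Here \<open>fact n * Suc n = fact (Suc n)\<close> turns \<open>A' n\<close> into
    \<open>A (Suc n)\<close> with the required factor.\<close>
  then have "has_nth_strong_derivative n (\<lambda>t x. \<Sum>k. t ^ k *\<^sub>R A' k x) (\<lambda>x. fact (Suc n) *\<^sub>R A (Suc n) x) 0"
    by (simp add: A'_def mult.commute)
  moreover have "\<forall>\<^sub>F t in nhds 0. has_strong_derivative (\<lambda>t x. \<Sum>k. t ^ k *\<^sub>R A k x) (\<lambda>x. \<Sum>k. t ^ k *\<^sub>R A' k x) t"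
  proof -
    have "\<forall>\<^sub>F t in nhds 0. t \<in> ball 0 R"
      using \<open>R > 0\<close> by (intro eventually_nhds_in_open) auto
    then show ?thesis
    proof eventually_elim
      case (elim t)
      then have t: "\<bar>t\<bar> < R" by simp
      show ?case
        unfolding has_strong_derivative_def
      proof (intro conjI allI)
        show "bounded_clinear (\<lambda>x. \<Sum>k. t ^ k *\<^sub>R A' k x)"
        proof (rule bounded_clinear_suminf)
          show "bounded_clinear (\<lambda>x. t ^ k *\<^sub>R A' k x)" for k
            by (intro bounded_clinear_scaleR A')
          show "norm (t ^ k *\<^sub>R A' k x) \<le> (c' k * \<bar>t\<bar> ^ k) * norm x" for k x
            using mult_left_mono[OF c'_bound[of k x], of "\<bar>t\<bar> ^ k"]
            by (simp add: power_abs mult_ac)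
          show "summable (\<lambda>k. c' k * \<bar>t\<bar> ^ k)"
            using c'_summable[of "\<bar>t\<bar>"] t by simp
        qed
        fix x
        show "((\<lambda>t. \<Sum>k. t ^ k *\<^sub>R A k x) has_vector_derivative (\<Sum>k. t ^ k *\<^sub>R A' k x)) (at t)"
          unfolding A'_def
        proof (rule has_vector_derivative_power_series[OF _ t])
          fix r :: real assume r: "\<bar>r\<bar> < R"
          show "summable (\<lambda>k. norm (A k x) * r ^ k)"
          proof (rule summable_comparison_test'[where N = 0])
            show "summable (\<lambda>k. (c k * \<bar>r\<bar> ^ k) * norm x)"
              using Suc.prems(3)[of "\<bar>r\<bar>"] r by (intro summable_mult2) simp
            show "norm (norm (A k x) * r ^ k) \<le> (c k * \<bar>r\<bar> ^ k) * norm x" for k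
              using mult_right_mono[OF Suc.prems(2)[of k x], of "\<bar>r\<bar> ^ k"]
              by (simp add: abs_mult power_abs mult_ac)
          qed
        qed
      qed
    qed
  qed
  ultimately show ?case by auto
qed

section \<open>Weak integrals of operators\<close>

text \<open>Dominated convergence: a convergent sequence \<open>u\<close> is bounded by some
  \<open>B\<close>, which gives the integrable majorant
  \<open>norm (\<rho> z) * (\<bar>K\<bar> * B)\<close>. It supplies the limit step of the density
  arguments.\<close>

lemma has_bochner_integral_bounded_linear_limit:
  fixes \<rho> :: "'z \<Rightarrow> complex" and f :: "'z \<Rightarrow> 'a::real_normed_vector \<Rightarrow> complex"
  assumes \<rho>: "integrable M \<rho>"
    and f: "\<And>z. bounded_linear (f z)" "\<And>z x. norm (f z x) \<le> K * norm x"
    and g: "bounded_linear g"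
    and u: "\<And>n. has_bochner_integral M (\<lambda>z. \<rho> z * f z (u n)) (g (u n))" "u \<longlonglongrightarrow> x"
  shows "has_bochner_integral M (\<lambda>z. \<rho> z * f z x) (g x)"
proof -
  have lim: "(\<lambda>n. \<rho> z * f z (u n)) \<longlonglongrightarrow> \<rho> z * f z x" for z
    by (intro tendsto_mult tendsto_const bounded_linear.tendsto[OF f(1)] u(2))
  have meas_u: "(\<lambda>z. \<rho> z * f z (u n)) \<in> borel_measurable M" for n
    using u(1)[of n] by (auto simp: has_bochner_integral_iff)
  then have meas: "(\<lambda>z. \<rho> z * f z x) \<in> borel_measurable M"
    using lim by (rule borel_measurable_LIMSEQ_metric)
  obtain B where B: "\<And>n. norm (u n) \<le> B"
    using convergent_imp_Bseq[of u] u(2) unfolding convergent_def Bseq_def by blast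
  have "norm (f z (u n)) \<le> \<bar>K\<bar> * B" for z n
  proof -
    have "norm (f z (u n)) \<le> \<bar>K\<bar> * norm (u n)"
      using f(2)[of z "u n"] by (meson abs_ge_self mult_right_mono norm_ge_zero order_trans)
    also have "\<dots> \<le> \<bar>K\<bar> * B" using B by (intro mult_left_mono) auto
    finally show ?thesis .
  qed
  then have dom: "AE z in M. norm (\<rho> z * f z (u n)) \<le> norm (\<rho> z) * (\<bar>K\<bar> * B)" for n
    by (auto simp: norm_mult intro!: mult_left_mono)
  have int: "integrable M (\<lambda>z. norm (\<rho> z) * (\<bar>K\<bar> * B))"
    using \<rho> by simp
  have lim': "AE z in M. (\<lambda>n. \<rho> z * f z (u n)) \<longlonglongrightarrow> \<rho> z * f z x"
    using lim by simp
  note dc = meas meas_u int lim' dom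
  have "integrable M (\<lambda>z. \<rho> z * f z x)"
    by (rule integrable_dominated_convergence[OF dc])
  moreover have "(\<lambda>n. integral\<^sup>L M (\<lambda>z. \<rho> z * f z (u n))) \<longlonglongrightarrow> integral\<^sup>L M (\<lambda>z. \<rho> z * f z x)"
    by (rule integral_dominated_convergence[OF dc])
  moreover have "integral\<^sup>L M (\<lambda>z. \<rho> z * f z (u n)) = g (u n)" for n
    using u(1)[of n] by (simp add: has_bochner_integral_iff)
  moreover have "(\<lambda>n. g (u n)) \<longlonglongrightarrow> g x"
    by (rule bounded_linear.tendsto[OF g u(2)])
  ultimately show ?thesis
    using LIMSEQ_unique by (simp add: has_bochner_integral_iff) blast
qed

text \<open>Two density arguments in succession: for \<open>y\<close> in \<open>S\<close> the
  identity extends to all \<open>x\<close>, then for fixed \<open>x\<close> to all \<open>y\<close>.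
  The second is run on the complex conjugates, because \<open>cinner\<close> is linear only in its
  second argument; the density \<open>\<rho>\<close> is real, so conjugation leaves it
  unchanged.\<close>

lemma has_operator_integral_total:
  fixes W :: "complex \<Rightarrow> 'h::chilbert_space \<Rightarrow> 'h" and \<rho> :: "complex \<Rightarrow> real"
  assumes W: "\<And>z. unitary (W z)" and T: "bounded_clinear T"
    and \<rho>: "integrable lborel \<rho>" and total: "closure (cspan S) = UNIV"
    and base: "\<And>x y. x \<in> S \<Longrightarrow> y \<in> S \<Longrightarrow>
      has_bochner_integral lborel (\<lambda>z. of_real (\<rho> z) * cinner y (W z x)) (cinner y (T x))"
  shows "has_operator_integral (\<lambda>z. of_real (\<rho> z)) W T"
  unfolding has_operator_integral_def
proof (intro conjI allI)
  show "bounded_clinear T" by fact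
  have \<rho>': "integrable lborel (\<lambda>z. complex_of_real (\<rho> z))"
    using \<rho> by simp
  have W_lin: "bounded_linear (W z)" "W z (c *\<^sub>C x) = c *\<^sub>C W z x" "W z (x + y) = W z x + W z y"
    and T_lin: "bounded_linear T" "T (c *\<^sub>C x) = c *\<^sub>C T x" "T (x + y) = T x + T y" for z c x y
    using W[of z] T by (auto simp: unitary_def bounded_clinear_def bounded_linear_def linear_add)
  have CS: "norm (cinner x y) \<le> norm x * norm y" for x y :: 'h
    by (rule Cauchy_Schwarz_cinner)
  have *: "has_bochner_integral lborel (\<lambda>z. of_real (\<rho> z) * cinner y (W z x)) (cinner y (T x))"
    if y: "y \<in> S" for x y
    using total
  proof (induction x rule: cspan_closure_induct)
    case (scale_add c x x')
    from has_bochner_integral_add[OF has_bochner_integral_mult_right[OF scale_add(1), of c] scale_add(2)]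
    show ?case
      by (simp add: W_lin T_lin cinner_add_right cinner_scaleC_right algebra_simps)
  next
    case (closed u x)
    show ?case
      by (rule has_bochner_integral_bounded_linear_limit[where K = "norm y" and f = "\<lambda>z x. cinner y (W z x)"
            and g = "\<lambda>x. cinner y (T x)", OF \<rho>' _ _ _ closed])
        (auto intro: bounded_linear_compose[OF bounded_linear_cinner_right] W_lin T_lin
          order_trans[OF CS] simp: unitary_norm[OF W])
  next
    case zero
    then show ?case using W_lin(2)[of _ 0] T_lin(2)[of 0] by (simp add: has_bochner_integral_zero)
  next
    case (base x)
    then show ?case using assms(5) y by blast
  qed
  fix x y
  \<comment> \<open>The conjugated identity is linear in \<open>y\<close>; its base case is the
    conjugate of \<open>*\<close>.\<close>
  have "has_bochner_integral lborel (\<lambda>z. of_real (\<rho> z) * cinner (W z x) y) (cinner (T x) y)"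
    using total
  proof (induction y rule: cspan_closure_induct)
    case (scale_add c y y')
    from has_bochner_integral_add[OF has_bochner_integral_mult_right[OF scale_add(1), of c] scale_add(2)]
    show ?case
      by (simp add: cinner_add_right cinner_scaleC_right algebra_simps)
  next
    case (closed u y)
    show ?case
      by (rule has_bochner_integral_bounded_linear_limit[where K = "norm x" and f = "\<lambda>z. cinner (W z x)"
            and g = "cinner (T x)", OF \<rho>' _ _ _ closed])
        (auto intro: bounded_linear_cinner_right order_trans[OF CS] simp: unitary_norm[OF W])
  next
    case zero
    then show ?case by (simp add: has_bochner_integral_zero)
  next
    case (base y)
    from has_bochner_integral_bounded_linear[OF bounded_linear_cnj *[OF base, of x]]
    show ?case by (simp flip: cinner_commute)
  qed
  from has_bochner_integral_bounded_linear[OF bounded_linear_cnj this]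
  show "has_bochner_integral lborel (\<lambda>z. of_real (\<rho> z) * cinner y (W z x)) (cinner y (T x))"
    by (simp flip: cinner_commute)
qed

section \<open>The number operator of a cyclic vacuum representation\<close>

locale vacuum_rep =
  fixes W :: "complex \<Rightarrow> 'h::chilbert_space \<Rightarrow> 'h" and \<Omega> :: 'h
  assumes rep: "cyclic_vacuum_rep W \<Omega>"
begin

section \<open>Exponential vectors and the action of the Weyl operators on them\<close>

text \<open>These are the exponential vectors of Fock space, that is, the coherent states without
  their Gaussian normalisation.\<close>

definition exp_vec :: "complex \<Rightarrow> 'h"
  where "exp_vec z = of_real (exp ((cmod z)\<^sup>2 / 2)) *\<^sub>C W z \<Omega>"

lemma unitary_W: "unitary (W z)"
  and W_W: "W z (W w x) = exp (- \<i> * of_real (Im (cnj z * w))) *\<^sub>C W (z + w) x"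
  and vacuum: "cinner \<Omega> (W z \<Omega>) = of_real (exp (- (1/2) * (cmod z)\<^sup>2))"
  and cyclic: "closure (cspan (range (\<lambda>z. W z \<Omega>))) = UNIV"
  using rep by (auto simp: cyclic_vacuum_rep_def)

lemma cinner_W: "cinner (W z x) (W z y) = cinner x y"
  and W_scaleC: "W z (c *\<^sub>C x) = c *\<^sub>C W z x"
  using unitary_W[of z] by (auto simp: unitary_def bounded_clinear_def)

text \<open>The relations give \<open>W 0 (W 0 x) = W 0 x\<close>, so the isometry
  \<open>W 0\<close> sends \<open>W 0 x - x\<close> to 0.\<close>

lemma W_0 [simp]: "W 0 x = x"
proof -
  have "W 0 (W 0 x - x) = W 0 (W 0 x) - W 0 x"
    using unitary_W[of 0] by (auto simp: unitary_def bounded_clinear_def bounded_linear_def linear_diff)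
  also have "\<dots> = 0" by (simp add: W_W)
  finally show ?thesis
    using unitary_norm[OF unitary_W[of 0], of "W 0 x - x"] by simp
qed

lemma W_vacuum: "W z \<Omega> = of_real (exp (- (1/2) * (cmod z)\<^sup>2)) *\<^sub>C exp_vec z"
  by (simp add: exp_vec_def scaleC_scaleC flip: of_real_mult exp_add)

text \<open>Applying the isometry \<open>W (- z)\<close> reduces the inner product to a vacuum
  expectation at \<open>w - z\<close>. Expanding \<open>(cmod (w - z))^2\<close> yields the real
  part of \<open>cnj z * w\<close>, and the phase of the relations its imaginary part.\<close>

lemma cinner_exp_vec: "cinner (exp_vec z) (exp_vec w) = exp (cnj z * w)"
proof -
  have "cinner (W z \<Omega>) (W w \<Omega>) = cinner (W (- z) (W z \<Omega>)) (W (- z) (W w \<Omega>))"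
    by (simp add: cinner_W)
  \<comment> \<open>The first argument becomes \<open>\<Omega>\<close> without a phase, because
    \<open>cnj z * z\<close> is real.\<close>
  also have "\<dots> = exp (- \<i> * of_real (Im (- cnj z * w))) * of_real (exp (- (1/2) * (cmod (w - z))\<^sup>2))"
    by (simp add: W_W cinner_scaleC_right vacuum)
  also have "\<dots> = exp (- \<i> * of_real (Im (- cnj z * w)) + of_real (- (1/2) * (cmod (w - z))\<^sup>2))"
    by (simp only: exp_add exp_of_real)
  finally have "cinner (exp_vec z) (exp_vec w) = exp (of_real ((cmod z)\<^sup>2 / 2) + of_real ((cmod w)\<^sup>2 / 2)
      + (- \<i> * of_real (Im (- cnj z * w)) + of_real (- (1/2) * (cmod (w - z))\<^sup>2)))"
    by (simp only: exp_vec_def cinner_scaleC_left cinner_scaleC_right exp_add exp_of_real complex_cnj_complex_of_real mult_ac)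
  also have "\<dots> = exp (cnj z * w)"
    by (intro arg_cong[where f = exp])
      (simp add: complex_eq_iff cmod_power2, simp add: field_simps power2_eq_square)
  finally show ?thesis .
qed

lemma norm_exp_vec: "(norm (exp_vec z))\<^sup>2 = exp ((cmod z)\<^sup>2)"
proof -
  have "complex_of_real ((norm (exp_vec z))\<^sup>2) = exp (cnj z * z)"
    by (simp only: cinner_exp_vec flip: cinner_self)
  also have "\<dots> = of_real (exp ((cmod z)\<^sup>2))"
    by (metis complex_norm_square exp_of_real mult.commute)
  finally show ?thesis by (simp only: of_real_eq_iff)
qed

text \<open>The two normalising factors combine to the real part
  \<open>- (cmod z)^2 / 2 - Re (cnj z * w)\<close> of the exponent, and the phase contributes the
  missing imaginary part.\<close>

lemma W_exp_vec: "W z (exp_vec w) = exp (- of_real ((cmod z)\<^sup>2 / 2) - cnj z * w) *\<^sub>C exp_vec (z + w)"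
proof -
  have "W z (exp_vec w) = (of_real (exp ((cmod w)\<^sup>2 / 2)) * (exp (- \<i> * of_real (Im (cnj z * w))) *
      of_real (exp (- (1/2) * (cmod (z + w))\<^sup>2)))) *\<^sub>C exp_vec (z + w)"
    by (simp add: exp_vec_def[of w] W_scaleC W_W W_vacuum[of "z + w"] scaleC_scaleC)
  also have "of_real (exp ((cmod w)\<^sup>2 / 2)) * (exp (- \<i> * of_real (Im (cnj z * w))) *
      of_real (exp (- (1/2) * (cmod (z + w))\<^sup>2)))
      = exp (of_real ((cmod w)\<^sup>2 / 2) + (- \<i> * of_real (Im (cnj z * w)) + of_real (- (1/2) * (cmod (z + w))\<^sup>2)))"
    by (simp only: exp_add exp_of_real)
  also have "\<dots> = exp (- of_real ((cmod z)\<^sup>2 / 2) - cnj z * w)"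
    by (intro arg_cong[where f = exp])
      (simp add: complex_eq_iff cmod_power2, simp add: field_simps power2_eq_square)
  finally show ?thesis .
qed

lemma total_exp_vec: "closure (cspan (range exp_vec)) = UNIV"
proof -
  interpret C: vector_space "scaleC :: complex \<Rightarrow> 'h \<Rightarrow> 'h"
    by (rule vector_space_scaleC)
  have "W z \<Omega> \<in> cspan (range exp_vec)" for z
    unfolding W_vacuum[of z] cspan_def by (intro C.span_scale C.span_base) auto
  then have "cspan (range (\<lambda>z. W z \<Omega>)) \<subseteq> cspan (range exp_vec)"
    unfolding cspan_def by (intro C.span_minimal) auto
  from closure_mono[OF this] show ?thesis by (auto simp: cyclic)
qed

text \<open>The squared distance of two exponential vectors expands into values of the kernel
  \<open>exp (cnj z * w)\<close>, which is continuous. Continuity makes the circle integral in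
  \<open>fock_vec\<close> exist.\<close>

lemma continuous_exp_vec: "continuous_on A exp_vec"
proof (intro continuous_at_imp_continuous_on ballI)
  fix w
  have "(norm (exp_vec z - exp_vec w))\<^sup>2 =
      Re (exp (cnj z * z) - exp (cnj z * w) - exp (cnj w * z) + exp (cnj w * w))" for z
  proof -
    have "complex_of_real ((norm (exp_vec z - exp_vec w))\<^sup>2) =
        exp (cnj z * z) - exp (cnj z * w) - exp (cnj w * z) + exp (cnj w * w)"
      unfolding cinner_self[symmetric] by (simp add: cinner_diff_left cinner_diff_right cinner_exp_vec)
    then show ?thesis by (metis Re_complex_of_real)
  qed
  then have eq: "norm (exp_vec z - exp_vec w) =
      sqrt (Re (exp (cnj z * z) - exp (cnj z * w) - exp (cnj w * z) + exp (cnj w * w)))" for z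
    by (metis norm_ge_zero real_sqrt_unique)
  have "((\<lambda>z. norm (exp_vec z - exp_vec w)) \<longlongrightarrow> sqrt (Re (exp (cnj w * w) - exp (cnj w * w) - exp (cnj w * w) + exp (cnj w * w)))) (at w)"
    unfolding eq by (intro tendsto_intros)
  then have "((\<lambda>z. exp_vec z - exp_vec w) \<longlongrightarrow> 0) (at w)"
    by (simp add: tendsto_norm_zero_iff)
  then show "isCont exp_vec w"
    unfolding isCont_def by (rule LIM_zero_cancel)
qed

section \<open>The number basis as Taylor coefficients of the exponential vectors\<close>

text \<open>Serves the uniqueness of the number basis: any family \<open>e\<close> that expands the
  exponential vectors has its inner products fixed by these circle integrals.\<close>

lemma has_integral_cinner_exp_vec:
  assumes "\<And>z. (\<lambda>n. (z ^ n / of_real (sqrt (fact n))) *\<^sub>C e n) sums exp_vec z"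
  shows "((\<lambda>t. cinner x (exp_vec (exp (2 * of_real pi * \<i> * of_real t))) / exp (2 * of_real pi * \<i> * of_real t) ^ n)
    has_integral (cinner x (e n) / of_real (sqrt (fact n)))) {0..1}"
proof -
  have "(\<lambda>k. (cinner x (e k) / of_real (sqrt (fact k))) * z ^ k) sums cinner x (exp_vec z)" for z
    using bounded_linear.sums[OF bounded_linear_cinner_right[of x] assms[of z]]
    by (simp add: cinner_scaleC_right mult.commute)
  from has_integral_circle_power_series[OF this] show ?thesis .
qed

text \<open>The basis vectors are the Taylor coefficients of the entire function \<^const>\<open>exp_vec\<close>, up to
  normalisation; Cauchy's formula yields them as integrals over the unit circle.\<close>

definition fock_vec :: "nat \<Rightarrow> 'h"
  where "fock_vec n = of_real (sqrt (fact n)) *\<^sub>C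
    integral {0..1} (\<lambda>t. (1 / exp (2 * of_real pi * \<i> * of_real t) ^ n) *\<^sub>C exp_vec (exp (2 * of_real pi * \<i> * of_real t)))"

text \<open>The bounded functional \<open>cinner x\<close> is pulled through the vector-valued
  integral, which reduces questions about \<open>fock_vec\<close> to Taylor coefficients of scalar
  functions.\<close>

lemma has_integral_cinner_fock_vec:
  "((\<lambda>t. cinner x (exp_vec (exp (2 * of_real pi * \<i> * of_real t))) / exp (2 * of_real pi * \<i> * of_real t) ^ n)
    has_integral (cinner x (fock_vec n) / of_real (sqrt (fact n)))) {0..1}"
proof -
  let ?f = "\<lambda>t::real. (1 / exp (2 * of_real pi * \<i> * of_real t) ^ n) *\<^sub>C exp_vec (exp (2 * of_real pi * \<i> * of_real t))"
  have "continuous_on {0..1} (\<lambda>t::real. exp_vec (exp (2 * of_real pi * \<i> * of_real t)))"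
    by (rule continuous_on_compose2[OF continuous_exp_vec[of UNIV]]) (auto intro!: continuous_intros)
  then have "continuous_on {0..1} ?f"
    by (intro bounded_bilinear.continuous_on[OF bounded_bilinear_scaleC] continuous_intros) auto
  then have "(?f has_integral integral {0..1} ?f) {0..1}"
    by (intro integrable_integral integrable_continuous_real)
  from has_integral_linear[OF this bounded_linear_cinner_right[of x]] show ?thesis
    by (simp add: o_def fock_vec_def cinner_scaleC_right)
qed

text \<open>The scalar function is \<open>z \<mapsto> exp (cnj w * z)\<close>, with coefficients
  \<open>cnj w ^ k / fact k\<close>; the normalisation of \<open>fock_vec\<close> cancels one of the
  two factors \<open>sqrt (fact n)\<close>.\<close>

lemma cinner_exp_vec_fock_vec: "cinner (exp_vec w) (fock_vec n) = cnj w ^ n / of_real (sqrt (fact n))"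
proof -
  have "(\<lambda>k. (cnj w ^ k / fact k) * z ^ k) sums exp (cnj w * z)" for z
    using exp_converges[of "cnj w * z"] by (simp add: scaleR_conv_of_real field_simps power_mult_distrib)
  from has_integral_circle_power_series[OF this, of n]
  have coeff: "cinner (exp_vec w) (fock_vec n) / of_real (sqrt (fact n)) = cnj w ^ n / fact n"
    using has_integral_cinner_fock_vec[of "exp_vec w" n] by (auto simp: cinner_exp_vec dest: has_integral_unique)
  have sqrt_fact: "(of_real (sqrt (fact n)) :: complex) * of_real (sqrt (fact n)) = fact n"
    by (simp flip: of_real_mult)
  have cancel: "c = d / r" if "c / r = d / k" "r * r = k" "r \<noteq> 0" for c d r k :: complex
    using that(1,3) unfolding that(2)[symmetric] by (simp add: field_simps)
  show ?thesis by (rule cancel[OF coeff sqrt_fact]) simp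
qed

lemma cinner_fock_vec_exp_vec: "cinner (fock_vec n) (exp_vec w) = w ^ n / of_real (sqrt (fact n))"
  by (subst cinner_commute) (simp add: cinner_exp_vec_fock_vec)

text \<open>Against \<open>fock_vec m\<close> the exponential vectors give the monomial
  \<open>z ^ m / sqrt (fact m)\<close>, whose only nonzero coefficient is the
  \<open>m\<close>-th.\<close>

lemma cinner_fock_vec: "cinner (fock_vec m) (fock_vec n) = (if m = n then 1 else 0)"
proof -
  let ?a = "\<lambda>k. if k = m then 1 / complex_of_real (sqrt (fact m)) else 0"
  have "(\<lambda>k. ?a k * z ^ k) sums cinner (fock_vec m) (exp_vec z)" for z
    using sums_single[of m "\<lambda>k. z ^ k / complex_of_real (sqrt (fact m))"]
    by (simp add: cinner_fock_vec_exp_vec if_distrib[of "\<lambda>c. c * _"] cong: if_cong)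
  from has_integral_circle_power_series[OF this, of n]
  have "cinner (fock_vec m) (fock_vec n) / of_real (sqrt (fact n)) = ?a n"
    using has_integral_cinner_fock_vec[of "fock_vec m" n] by (rule has_integral_unique[rotated])
  then show ?thesis by (auto split: if_splits simp: field_simps)
qed

text \<open>Parseval's equality holds because the squared coefficients form the exponential series
  of \<open>(cmod z)^2\<close>, whose sum is the squared norm of \<open>exp_vec z\<close>.\<close>

lemma fock_vec_sums: "(\<lambda>n. (z ^ n / of_real (sqrt (fact n))) *\<^sub>C fock_vec n) sums exp_vec z"
proof -
  have "(cmod (cinner (fock_vec n) (exp_vec z)))\<^sup>2 = ((cmod z)\<^sup>2) ^ n /\<^sub>R fact n" for n
    by (simp add: cinner_fock_vec_exp_vec norm_divide norm_power power_divide field_simps flip: power_mult)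
  then have "(\<lambda>n. (cmod (cinner (fock_vec n) (exp_vec z)))\<^sup>2) sums (norm (exp_vec z))\<^sup>2"
    using exp_converges[of "(cmod z)\<^sup>2"] by (simp only: norm_exp_vec)
  from orthonormal_sums_if_Parseval[OF cinner_fock_vec this] show ?thesis
    by (simp add: cinner_fock_vec_exp_vec)
qed

text \<open>Each exponential vector is the limit of its partial sums over the
  \<open>fock_vec n\<close>, and the exponential vectors are total.\<close>

lemma orthonormal_basis_fock_vec: "orthonormal_basis fock_vec"
proof -
  interpret C: vector_space "scaleC :: complex \<Rightarrow> 'h \<Rightarrow> 'h"
    by (rule vector_space_scaleC)
  have "x \<in> closure (cspan (range fock_vec))" for x
    using total_exp_vec
  proof (induction x rule: cspan_closure_induct)
    case (scale_add c x y)
    then show ?case by (rule closure_cspan_scale_add)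
  next
    case (closed f x)
    then show ?case by (rule closed_sequentially[OF closed_closure])
  next
    case zero
    show ?case using closure_subset C.span_zero by (auto simp: cspan_def)
  next
    case (base x)
    then obtain z where z: "x = exp_vec z" by auto
    have in_span: "(\<Sum>n<m. (z ^ n / of_real (sqrt (fact n))) *\<^sub>C fock_vec n) \<in> cspan (range fock_vec)" for m
      unfolding cspan_def by (intro C.span_sum C.span_scale C.span_base) auto
    show ?case
      unfolding z
    proof (rule closed_sequentially[OF closed_closure])
      show "(\<lambda>m. \<Sum>n<m. (z ^ n / of_real (sqrt (fact n))) *\<^sub>C fock_vec n) \<longlonglongrightarrow> exp_vec z"
        using fock_vec_sums[of z] by (simp add: sums_def)
      show "(\<Sum>n<m. (z ^ n / of_real (sqrt (fact n))) *\<^sub>C fock_vec n) \<in> closure (cspan (range fock_vec))" for m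
        using in_span[of m] closure_subset by blast
    qed
  qed
  then show ?thesis by (auto simp: orthonormal_basis_def cinner_fock_vec)
qed

text \<open>Evaluates the \<open>THE\<close> in \<open>number_basis\<close>. For uniqueness, a
  competing family has the same circle integrals as \<open>fock_vec\<close>, hence the same inner
  product with every vector.\<close>

lemma number_basis_eq: "number_basis W \<Omega> = fock_vec"
proof -
  \<comment> \<open>The defining expansion of \<open>W z \<Omega>\<close> and that of
    \<open>exp_vec z\<close> differ by the factor \<open>exp ((cmod z)^2 / 2)\<close>, which can be
    multiplied in or out.\<close>
  have *: "(\<forall>z. (\<lambda>n. (of_real (exp (- (1/2) * (cmod z)\<^sup>2)) * (z ^ n / of_real (sqrt (fact n)))) *\<^sub>C e n)
          sums W z \<Omega>) \<longleftrightarrow> (\<forall>z. (\<lambda>n. (z ^ n / of_real (sqrt (fact n))) *\<^sub>C e n) sums exp_vec z)" (is "?L \<longleftrightarrow> ?R") for e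
  proof
    note sums_scale = bounded_linear.sums[OF bounded_bilinear.bounded_linear_right[OF bounded_bilinear_scaleC]]
    show ?R if ?L
    proof
      fix z
      from sums_scale[OF that[rule_format, of z], of "of_real (exp ((cmod z)\<^sup>2 / 2))"]
      show "(\<lambda>n. (z ^ n / of_real (sqrt (fact n))) *\<^sub>C e n) sums exp_vec z"
        by (simp add: exp_vec_def scaleC_scaleC mult.assoc[symmetric] flip: of_real_mult exp_add)
    qed
    show ?L if ?R
    proof
      fix z
      from sums_scale[OF that[rule_format, of z], of "of_real (exp (- (1/2) * (cmod z)\<^sup>2))"]
      show "(\<lambda>n. (of_real (exp (- (1/2) * (cmod z)\<^sup>2)) * (z ^ n / of_real (sqrt (fact n)))) *\<^sub>C e n) sums W z \<Omega>"
        by (simp add: W_vacuum scaleC_scaleC)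
    qed
  qed
  show ?thesis
    unfolding number_basis_def *
  proof (rule the_equality)
    show "orthonormal_basis fock_vec \<and> (\<forall>z. (\<lambda>n. (z ^ n / of_real (sqrt (fact n))) *\<^sub>C fock_vec n) sums exp_vec z)"
      using orthonormal_basis_fock_vec fock_vec_sums by blast
  next
    fix e assume e: "orthonormal_basis e \<and> (\<forall>z. (\<lambda>n. (z ^ n / of_real (sqrt (fact n))) *\<^sub>C e n) sums exp_vec z)"
    show "e = fock_vec"
    proof
      fix n
      have "cinner x (e n) / of_real (sqrt (fact n)) = cinner x (fock_vec n) / of_real (sqrt (fact n))" for x
        using has_integral_cinner_exp_vec[of e x n] has_integral_cinner_fock_vec[of x n] e
        by (blast dest: has_integral_unique)
      then have "cinner (e n - fock_vec n) (e n - fock_vec n) = 0"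
        by (simp add: cinner_diff_right)
      then show "e n = fock_vec n" by (simp add: cinner_self)
    qed
  qed
qed

section \<open>The projections \<open>P_n\<close> and the operators \<open>s^N\<close>\<close>

text \<open>The eigenvalue \<open>n\<close> is simple: its eigenspace is the line through the unit
  vector \<open>fock_vec n\<close>.\<close>

lemma number_proj_eq: "number_proj W \<Omega> n x = cinner (fock_vec n) x *\<^sub>C fock_vec n"
  by (simp add: number_proj_def number_op_def number_basis_eq orth_proj_cspan_singleton cinner_fock_vec
      eigenspace_number_op_of[OF orthonormal_basis_fock_vec])

lemma norm_number_proj_le: "norm (number_proj W \<Omega> n x) \<le> norm x"
proof -
  have "norm (fock_vec n) = 1"
    by (simp add: norm_eq_sqrt_cinner cinner_fock_vec)
  then show ?thesis
    using Cauchy_Schwarz_cinner[of "fock_vec n" x] by (simp add: number_proj_eq norm_scaleC)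
qed

lemma bounded_clinear_number_proj: "bounded_clinear (number_proj W \<Omega> n)"
  by (rule bounded_clinearI[where K = 1])
    (simp_all add: norm_number_proj_le, simp_all add: number_proj_eq cinner_add_right cinner_scaleC_right
      scaleC_add_left scaleC_scaleC)

lemma bounded_clinear_number_power:
  assumes "\<bar>s\<bar> < 1"
  shows "bounded_clinear (number_power W \<Omega> s)"
  unfolding number_power_def
proof (rule bounded_clinear_suminf)
  show "bounded_clinear (\<lambda>x. s ^ n *\<^sub>R number_proj W \<Omega> n x)" for n
    by (intro bounded_clinear_scaleR bounded_clinear_number_proj)
  show "norm (s ^ n *\<^sub>R number_proj W \<Omega> n x) \<le> \<bar>s\<bar> ^ n * norm x" for n x
    using norm_number_proj_le[of n x] by (simp add: power_abs mult_left_mono)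
  show "summable (\<lambda>n. \<bar>s\<bar> ^ n)"
    using assms by (simp add: summable_geometric)
qed

text \<open>The factor \<open>s ^ n\<close> is absorbed into the \<open>n\<close>-th power of the
  argument, and the expansion of exponential vectors converges everywhere, so \<open>s\<close> may
  be any real number here.\<close>

lemma number_power_exp_vec: "number_power W \<Omega> s (exp_vec w) = exp_vec (of_real s * w)"
proof -
  have "s ^ n *\<^sub>R number_proj W \<Omega> n (exp_vec w) =
      ((of_real s * w) ^ n / of_real (sqrt (fact n))) *\<^sub>C fock_vec n" for n
    by (simp add: number_proj_eq cinner_fock_vec_exp_vec scaleR_scaleC scaleC_scaleC power_mult_distrib)
  then show ?thesis
    unfolding number_power_def using fock_vec_sums[of "of_real s * w"] by (simp add: sums_iff)
qed

text \<open>By totality only pairs of exponential vectors have to be checked, and for those the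
  integrand is a Gaussian in \<open>z\<close> with linear terms.\<close>

lemma has_operator_integral_number_power:
  assumes s: "-1 < s" "s < 1"
  shows "has_operator_integral (\<lambda>z. of_real (exp (- (1/2) * ((1 + s) / (1 - s)) * (cmod z)\<^sup>2) / (1 - s))) W
    (\<lambda>x. pi *\<^sub>R number_power W \<Omega> s x)"
proof (rule has_operator_integral_total[OF unitary_W _ _ total_exp_vec])
  show "bounded_clinear (\<lambda>x. pi *\<^sub>R number_power W \<Omega> s x)"
    using s by (intro bounded_clinear_scaleR bounded_clinear_number_power) auto
  \<comment> \<open>The decay rate of the density; its positivity for \<open>-1 < s < 1\<close>
    gives integrability.\<close>
  define a where "a = (1/2) * ((1 + s) / (1 - s))"
  have "a > 0" using s by (simp add: a_def)
  from has_bochner_integral_gaussian_complex[OF this, of 0 0]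
  have "has_bochner_integral lborel (\<lambda>z. complex_of_real (exp (- (a * (cmod z)\<^sup>2)))) (of_real (pi / a))"
    by (simp flip: exp_of_real)
  then have "integrable lborel (\<lambda>z. exp (- (a * (cmod z)\<^sup>2)))"
    using integrable_Re by (fastforce simp: has_bochner_integral_iff)
  then show "integrable lborel (\<lambda>z. exp (- (1/2) * ((1 + s) / (1 - s)) * (cmod z)\<^sup>2) / (1 - s))"
    unfolding a_def by (intro integrable_divide) simp
next
  fix x y assume "x \<in> range exp_vec" "y \<in> range exp_vec"
  then obtain w v where x: "x = exp_vec w" and y: "y = exp_vec v" by auto
  \<comment> \<open>The Weyl operator adds \<open>1/2\<close> to the decay rate of the density:
    \<open>(1/2) * ((1 + s) / (1 - s)) + 1/2 = 1 / (1 - s)\<close>. The prefactor of the density is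
    the same number \<open>b\<close>.\<close>
  define b where "b = 1 / (1 - s)"
  have b: "b > 0" using s by (simp add: b_def)
  let ?c = "of_real b * exp (cnj v * w)"
  \<comment> \<open>The coefficients come from \<open>cinner y (W z x) = exp (- (cmod z)^2 / 2 - cnj
    z * w + cnj v * (z + w))\<close>; the part free of \<open>z\<close> is in
    \<open>?c\<close>.\<close>
  have "has_bochner_integral lborel (\<lambda>z. ?c * exp (- of_real (b * (cmod z)\<^sup>2) + cnj v * z + (- w) * cnj z))
      (?c * (of_real (pi / b) * exp (cnj v * (- w) / of_real b)))"
    by (intro has_bochner_integral_mult_right has_bochner_integral_gaussian_complex b)
  moreover have "?c * exp (- of_real (b * (cmod z)\<^sup>2) + cnj v * z + (- w) * cnj z) =
      of_real (exp (- (1/2) * ((1 + s) / (1 - s)) * (cmod z)\<^sup>2) / (1 - s)) * cinner y (W z x)" for z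
  proof -
    have half: "- (1/2) * ((1 + s) / (1 - s)) = 1 / 2 - b"
      using s by (simp add: b_def field_simps)
    show ?thesis
      unfolding half x y W_exp_vec cinner_scaleC_right cinner_exp_vec of_real_divide exp_of_real[symmetric]
      using s by (simp add: b_def algebra_simps flip: exp_add)
  qed
  moreover have "?c * (of_real (pi / b) * exp (cnj v * (- w) / of_real b)) =
      cinner y (pi *\<^sub>R number_power W \<Omega> s x)"
  proof -
    have "?c * (of_real (pi / b) * exp (cnj v * (- w) / of_real b)) =
        of_real pi * exp (cnj v * w + cnj v * (- w) / of_real b)"
      unfolding exp_add using b by simp
    \<comment> \<open>Since \<open>1 / b = 1 - s\<close>, only \<open>s\<close> times
      \<open>cnj v * w\<close> remains, which is the exponent in the inner product of
      \<open>exp_vec v\<close> and \<open>exp_vec (s * w)\<close>.\<close>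
    also have "cnj v * w + cnj v * (- w) / of_real b = cnj v * (of_real s * w)"
      using s by (simp add: b_def algebra_simps)
    finally show ?thesis
      by (simp add: x y number_power_exp_vec scaleR_scaleC cinner_scaleC_right cinner_exp_vec)
  qed
  ultimately show "has_bochner_integral lborel
      (\<lambda>z. of_real (exp (- (1/2) * ((1 + s) / (1 - s)) * (cmod z)\<^sup>2) / (1 - s)) * cinner y (W z x))
      (cinner y (pi *\<^sub>R number_power W \<Omega> s x))"
    by simp
qed

text \<open>Projections are contractions, so the constant coefficient bound 1 makes the power series
  converge for \<open>\<bar>s\<bar> < 1\<close>.\<close>

lemma has_nth_strong_derivative_number_power:
  "has_nth_strong_derivative n (number_power W \<Omega>) (\<lambda>x. fact n *\<^sub>R number_proj W \<Omega> n x) 0"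
proof -
  have "number_power W \<Omega> = (\<lambda>t x. \<Sum>k. t ^ k *\<^sub>R number_proj W \<Omega> k x)"
    by (intro ext) (rule number_power_def)
  moreover have "has_nth_strong_derivative n (\<lambda>t x. \<Sum>k. t ^ k *\<^sub>R number_proj W \<Omega> k x)
      (\<lambda>x. fact n *\<^sub>R number_proj W \<Omega> n x) 0"
  proof (rule has_nth_strong_derivative_power_series[where c = "\<lambda>_. 1" and R = 1])
    show "summable (\<lambda>k. 1 * r ^ k)" if "\<bar>r\<bar> < 1" for r :: real
      using that by (simp add: summable_geometric)
  qed (auto simp: bounded_clinear_number_proj norm_number_proj_le)
  ultimately show ?thesis by (simp only:)
qed

end

theorem lemma1p30:
  fixes W :: "complex \<Rightarrow> 'h::chilbert_space \<Rightarrow> 'h" and \<Omega> :: 'h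
  assumes "cyclic_vacuum_rep W \<Omega>"
  shows "(\<forall>s::real. -1 < s \<and> s < 1 \<longrightarrow>
            (\<exists>T. has_operator_integral
                   (\<lambda>z. of_real (exp (- (1/2) * ((1 + s) / (1 - s)) * (cmod z)\<^sup>2) / (1 - s))) W T \<and>
                 number_power W \<Omega> s = (\<lambda>x. (1 / pi) *\<^sub>R T x))) \<and>
         (\<forall>n. \<exists>D. has_nth_strong_derivative n (number_power W \<Omega>) D 0 \<and>
                 number_proj W \<Omega> n = (\<lambda>x. (1 / fact n) *\<^sub>R D x))"
proof (intro conjI allI impI)
  interpret vacuum_rep W \<Omega> by (rule vacuum_rep.intro) fact
  fix s :: real assume "-1 < s \<and> s < 1"
  then show "\<exists>T. has_operator_integral
      (\<lambda>z. of_real (exp (- (1/2) * ((1 + s) / (1 - s)) * (cmod z)\<^sup>2) / (1 - s))) W T \<and>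
      number_power W \<Omega> s = (\<lambda>x. (1 / pi) *\<^sub>R T x)"
    by (intro exI[of _ "\<lambda>x. pi *\<^sub>R number_power W \<Omega> s x"] conjI has_operator_integral_number_power) auto
next
  interpret vacuum_rep W \<Omega> by (rule vacuum_rep.intro) fact
  fix n
  show "\<exists>D. has_nth_strong_derivative n (number_power W \<Omega>) D 0 \<and>
      number_proj W \<Omega> n = (\<lambda>x. (1 / fact n) *\<^sub>R D x)"
    by (intro exI[of _ "\<lambda>x. fact n *\<^sub>R number_proj W \<Omega> n x"])
      (use has_nth_strong_derivative_number_power in auto)
qed

end
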